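(* Let $S=3$, so $\mathcal{S}=\{1,2,3\}$, let $Q(\cdot)$ be a nonlinear generator on $\mathcal{P}(\{1,2,3\})$ and let $(\Phi^t(\cdot))_{t\ge0}$ be the nonlinear Markov semigroup of the nonlinear Markov chain with generator $Q(\cdot)$. Let $F=\{(m_1,m_2)\in[0,\infty)^2: m_1+m_2\le 1\}$. Let $O\supseteq F$ be a simply connected and bounded region in $\mathbb{R}^2$ such that there is a continuously differentiable function $f=(f_1,f_2):O\rightarrow\mathbb{R}^2$ satisfying, for all $(m_1,m_2)\in F$ and with $\hat m=(m_1,m_2,1-m_1-m_2)$, $$f\begin{pmatrix} m_1\\ m_2\end{pmatrix}=\begin{pmatrix} Q_{31}(\hat m)+(Q_{11}(\hat m)-Q_{31}(\hat m))m_1+(Q_{21}(\hat m)-Q_{31}(\hat m))m_2\\ Q_{32}(\hat m)+(Q_{12}(\hat m)-Q_{32}(\hat m))m_1+(Q_{22}(\hat m)-Q_{32}(\hat m))m_2 \end{pmatrix}.$$ Let $\bar m$ be the unique stationary point given $Q(\cdot)$ (i.e. the invariant distribution is unique and equals $\bar m$); below, $\bar m$ as an argument of $f$ and its derivatives is identified with $(\bar m_1,\bar m_2)\in F$. Furthermore, assume that (a) $\frac{\partial f_1}{\partial m_1}(m)+\frac{\partial f_2}{\partial m_2}(m)$ is non-vanishing for all $m\in O$ and has uniform sign on $O$, (b) it holds that $$\frac{\partial f_1}{\partial m_1}(\bar m)\cdot\frac{\partial f_2}{\partial m_2}(\bar m)-\frac{\partial f_1}{\partial m_2}(\bar m)\cdot\frac{\partial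 f_2}{\partial m_1}(\bar m)>0$$ or it holds that $$\left(\frac{\partial f_1}{\partial m_1}(\bar m)+\frac{\partial f_2}{\partial m_2}(\bar m)\right)^2-4\left(\frac{\partial f_1}{\partial m_1}(\bar m)\cdot\frac{\partial f_2}{\partial m_2}(\bar m)-\frac{\partial f_1}{\partial m_2}(\bar m)\cdot\frac{\partial f_2}{\partial m_1}(\bar m)\right)<0.$$ Then the nonlinear Markov chain is strongly ergodic.
   Context: $\mathcal{P}(\mathcal{S})=\{m\in\mathbb{R}^S: m_i\ge 0,\ \sum_{i\in\mathcal{S}}m_i=1\}$ is the probability simplex over the finite state space $\mathcal{S}=\{1,\ldots,S\}$. A transition rate matrix is a real $S\times S$ matrix with non-negative off-diagonal entries and all row sums equal to $0$ (conservative). A transition rate matrix function is a map $Q:\mathcal{P}(\mathcal{S})\to\mathbb{R}^{S\times S}$ such that $Q(m)$ is a transition rate matrix for every $m\in\mathcal{P}(\mathcal{S})$. A region is a non-empty open connected set. A continuous family of nonlinear transition probabilities is a family of stochastic matrices $P(t,m)=(P_{ij}(t,m))_{i,j\in\mathcal{S}}$ depending continuously on $t\ge 0$ and $m\in\mathcal{P}(\mathcal{S})$ and satisfying the nonlinear Chapman-Kolmogorov equation $\sum_i m_iP_{ij}(t+s,m)=\sum_{i,k}m_iP_{ik}(t,m)P_{kj}(s,\sum_l m_lP_l(t,m))$, where $P_l(t,m)$ denotes the $l$-th row. It yields a nonlinear Markov semigroup $(\Phi^t(\cdot))_{t\ge0}$ of continuous transformations of $\mathcal{P}(\mathcal{S})$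 via $\Phi^t_j(m)=\sum_i m_iP_{ij}(t,m)$; it satisfies $\Phi^{t+s}=\Phi^t\Phi^s$ and $\Phi^0(m)=m$. $\Phi^t(m_0)$ is the marginal distribution at time $t$ of the nonlinear Markov chain with initial distribution $m_0$. A transition rate matrix function $Q$ is the nonlinear (infinitesimal) generator of the semigroup if $\Phi^t(m)$ is differentiable in $t=0$ for all $m\in\mathcal{P}(\mathcal{S})$ and $\left.\frac{\partial}{\partial t}\Phi^t_j(m)\right|_{t=0}=\sum_i m_iQ_{ij}(m)$ for all $j\in\mathcal{S}$ and $m\in\mathcal{P}(\mathcal{S})$. By the semigroup identity, $\Phi^t(m_0)$ then solves $\frac{\partial}{\partial t}\Phi^t(m_0)=\Phi^t(m_0)Q(\Phi^t(m_0))$ (row vector convention), $\Phi^0(m_0)=m_0$. $m\in\mathcal{P}(\mathcal{S})$ is an invariant distribution (stationary point given $Q$) if $0=m^TQ(m)$. The nonlinear Markov chain with semigroup $(\Phi^t(\cdot))_{t\ge0}$ is strongly ergodic if there exists $m^*\in\mathcal{P}(\mathcal{S})$ such that $\lim_{t\to\infty}\|\Phi^t(m_0)-m^*\|=0$ for all $m_0\in\mathcal{P}(\mathcal{S})$. *)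

theory Defs
  imports "HOL-Analysis.Analysis"
begin

(* The state space {1,...,S} is a finite index type 'n.  For S = 3 it is the numeral type 3,
   whose elements are 1, 2, 3 (there 3 = 0).  Distributions are row vectors, acting through v*. *)

definition prob_simplex :: "(real^'n) set" where
  "prob_simplex = {m. (\<forall>i. 0 \<le> m $ i) \<and> (\<Sum>i\<in>UNIV. m $ i) = 1}"

definition transition_rate_matrix :: "real^'n^'n \<Rightarrow> bool" where
  "transition_rate_matrix A \<longleftrightarrow>
     (\<forall>i j. i \<noteq> j \<longrightarrow> 0 \<le> A $ i $ j) \<and> (\<forall>i. (\<Sum>j\<in>UNIV. A $ i $ j) = 0)"

definition transition_rate_matrix_function :: "(real^'n \<Rightarrow> real^'n^'n) \<Rightarrow> bool" where
  "transition_rate_matrix_function Q \<longleftrightarrow> (\<forall>m\<in>prob_simplex. transition_rate_matrix (Q m))"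

definition stochastic_matrix :: "real^'n^'n \<Rightarrow> bool" where
  "stochastic_matrix A \<longleftrightarrow> (\<forall>i j. 0 \<le> A $ i $ j) \<and> (\<forall>i. (\<Sum>j\<in>UNIV. A $ i $ j) = 1)"

(* Joint continuity in (t, m) on [0,\<infinity>) x prob_simplex; P t m $ l is the l-th row. *)
definition nonlinear_transition_probabilities :: "(real \<Rightarrow> real^'n \<Rightarrow> real^'n^'n) \<Rightarrow> bool" where
  "nonlinear_transition_probabilities P \<longleftrightarrow>
     (\<forall>t\<ge>0. \<forall>m\<in>prob_simplex. stochastic_matrix (P t m)) \<and>
     continuous_on ({0..} \<times> prob_simplex) (\<lambda>(t, m). P t m) \<and>
     (\<forall>t\<ge>0. \<forall>s\<ge>0. \<forall>m\<in>prob_simplex. \<forall>j.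
        (\<Sum>i\<in>UNIV. m $ i * P (t + s) m $ i $ j) =
        (\<Sum>i\<in>UNIV. \<Sum>k\<in>UNIV. m $ i * P t m $ i $ k *
            P s (\<Sum>l\<in>UNIV. m $ l *\<^sub>R (P t m $ l)) $ k $ j))"

(* The Chapman-Kolmogorov equation gives the semigroup identity for \<Phi>, but at t = 0 only that
   \<Phi> 0 is idempotent; the identity \<Phi> 0 m = m is therefore part of the definition. *)
definition nonlinear_markov_semigroup :: "(real \<Rightarrow> real^'n \<Rightarrow> real^'n) \<Rightarrow> bool" where
  "nonlinear_markov_semigroup \<Phi> \<longleftrightarrow>
     (\<exists>P. nonlinear_transition_probabilities P \<and>
        (\<forall>t\<ge>0. \<forall>m\<in>prob_simplex. \<forall>j. \<Phi> t m $ j = (\<Sum>i\<in>UNIV. m $ i * P t m $ i $ j))) \<and>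
     (\<forall>m\<in>prob_simplex. \<Phi> 0 m = m)"

(* \<Phi> is given for t \<ge> 0 only, so the derivative at 0 is one-sided. *)
definition nonlinear_generator ::
  "(real^'n \<Rightarrow> real^'n^'n) \<Rightarrow> (real \<Rightarrow> real^'n \<Rightarrow> real^'n) \<Rightarrow> bool" where
  "nonlinear_generator Q \<Phi> \<longleftrightarrow>
     transition_rate_matrix_function Q \<and>
     (\<forall>m\<in>prob_simplex. \<forall>j.
        ((\<lambda>t. \<Phi> t m $ j) has_real_derivative (\<Sum>i\<in>UNIV. m $ i * Q m $ i $ j)) (at 0 within {0..}))"

definition invariant_distribution :: "(real^'n \<Rightarrow> real^'n^'n) \<Rightarrow> real^'n \<Rightarrow> bool" where
  "invariant_distribution Q m \<longleftrightarrow> m \<in> prob_simplex \<and> m v* Q m = 0"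

definition strongly_ergodic :: "(real \<Rightarrow> real^'n \<Rightarrow> real^'n) \<Rightarrow> bool" where
  "strongly_ergodic \<Phi> \<longleftrightarrow>
     (\<exists>m'\<in>prob_simplex. \<forall>m0\<in>prob_simplex. ((\<lambda>t. norm (\<Phi> t m0 - m')) \<longlongrightarrow> 0) at_top)"

definition region :: "'a::topological_space set \<Rightarrow> bool" where
  "region D \<longleftrightarrow> D \<noteq> {} \<and> open D \<and> connected D"

definition continuously_differentiable_on :: "(real^'n \<Rightarrow> real^'m) \<Rightarrow> (real^'n) set \<Rightarrow> bool" where
  "continuously_differentiable_on f D \<longleftrightarrow>
     (\<forall>x\<in>D. f differentiable at x) \<and> continuous_on D (\<lambda>x. jacobian f (at x))"

(* The partial derivative of f_i with respect to the j-th coordinate. *)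
abbreviation partial_derivative :: "(real^'n \<Rightarrow> real^'m) \<Rightarrow> 'm \<Rightarrow> 'n \<Rightarrow> real^'n \<Rightarrow> real" where
  "partial_derivative f i j x \<equiv> jacobian f (at x) $ i $ j"

definition F :: "(real^2) set" where
  "F = {m. 0 \<le> m $ 1 \<and> 0 \<le> m $ 2 \<and> m $ 1 + m $ 2 \<le> 1}"

definition hat :: "real^2 \<Rightarrow> real^3" where
  "hat m = vector [m $ 1, m $ 2, 1 - m $ 1 - m $ 2]"

definition proj12 :: "real^3 \<Rightarrow> real^2" where
  "proj12 m = vector [m $ 1, m $ 2]"

end

theory Submission
  imports Defs "HOL-Real_Asymp.Real_Asymp"
begin

text \<open>
  In the coordinates \<open>(m\<^sub>1, m\<^sub>2)\<close> the semigroup becomes a continuous semiflow on the triangle \<open>F\<close>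
  whose orbits solve \<open>x' = f x\<close>, and the zeros of \<open>f\<close> in \<open>F\<close> are exactly the invariant
  distributions; so there is one zero \<open>p\<close>. The divergence of \<open>f\<close> cannot be positive, as the
  semiflow maps the triangle into itself; hence it is negative, and the flow contracts area
  (\<open>expanding_field_null_set\<close>). Both alternatives of the local condition make the determinant of
  the Jacobian at \<open>p\<close> positive, and as its trace is negative, \<open>p\<close> attracts a neighbourhood of itself
  in \<open>F\<close> (\<open>linearly_stable_imp_attracting\<close>).

  The global statement \<open>contracting_flow_converges\<close> is a form of the Bendixson criterion, proved
  here without the Poincare-Bendixson theorem and the Jordan curve theorem. If some point were not
  attracted by \<open>p\<close>, there would be a minimal set \<open>N\<close> on which \<open>f\<close> has no zero.

  On the one hand \<open>N\<close> does not separate the plane: a bounded component of its complement would be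
  mapped onto itself by the flow, which contracts area (\<open>invariant_set_connected_complement\<close>). By
  Borsuk's separation theorem the zero-free field \<open>f\<close> then has a continuous logarithm on \<open>N\<close>; its
  argument is a continuous real function on \<open>N\<close>.

  On the other hand every orbit in a minimal set is recurrent. Consider the orbit through a lowest
  point of \<open>N\<close>. When it comes back close to that point, the argument of its velocity has almost
  returned to its initial value, because it is a function of the position. Following the direction
  of the chords of the orbit arc in between, as in Hopf's proof of the theorem on turning tangents,
  shows instead that the argument has increased by more than a quarter turn
  (\<open>no_recurrent_curve\<close>). This contradiction proves the theorem.
\<close>

section \<open>Recurrent curves and lowest points\<close>

lemma stays_above:
  fixes h :: "real \<Rightarrow> real"
  assumes "continuous_on {a..b} h" "a \<le> b" "h a > c" "\<And>u. u \<in> {a..b} \<Longrightarrow> h u \<noteq> c"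
  shows "h b > c"
proof (rule ccontr)
  assume "\<not> h b > c"
  then have "\<exists>u. a \<le> u \<and> u \<le> b \<and> h u = c"
    using IVT2'[of h b c a] assms by auto
  then show False using assms(4) by auto
qed

lemma strictly_increasing_Re:
  fixes x :: "real \<Rightarrow> complex"
  assumes "\<And>t. t \<in> {a..b} \<Longrightarrow> (x has_vector_derivative x' t) (at t within {0..})"
    and "\<And>t. t \<in> {a..b} \<Longrightarrow> Re (x' t) > 0" and "0 \<le> a" "a < b"
  shows "Re (x a) < Re (x b)"
proof -
  have d: "((\<lambda>t. Re (x t)) has_real_derivative Re (x' t)) (at t within {a..b})" if "t \<in> {a..b}" for t
  proof -
    have "(x has_vector_derivative x' t) (at t within {a..b})"
      using assms(1)[OF that] \<open>0 \<le> a\<close> by (auto intro: has_vector_derivative_within_subset)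
    from bounded_linear.has_vector_derivative[OF bounded_linear_Re this]
    show ?thesis by (simp add: has_real_derivative_iff_has_vector_derivative)
  qed
  have "continuous_on {a..b} (\<lambda>t. Re (x t))"
    using d by (meson DERIV_continuous_on)
  moreover have "\<exists>y. DERIV (\<lambda>t. Re (x t)) t :> y \<and> y > 0" if "a < t" "t < b" for t
    using d[of t] that assms(2)[of t] by (metis at_within_Icc_at atLeastAtMost_iff less_eq_real_def)
  ultimately show ?thesis
    using DERIV_pos_imp_increasing_open[of a b "\<lambda>t. Re (x t)"] \<open>a < b\<close> by blast
qed

text \<open>
  A recurrent curve in the plane whose velocity has a continuous argument that is a function of the
  position alone cannot pass through a lowest point of its range. The velocity is written as
  \<open>exp \<circ> g\<close>, so that the argument is \<open>Im \<circ> g\<close>; the lowest point is reached at time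
  \<open>1\<close> with velocity pointing to the right. The proof lifts the direction of the chord from
  \<open>x s\<close> to \<open>x t\<close> continuously over a trapezoid of pairs \<open>(s, t)\<close>, as in Hopf's proof of the
  theorem on turning tangents: along a suitable path of chords that begins and ends with a tangent,
  the direction turns by more than \<open>pi/2\<close>, although both tangents point nearly to the right.
\<close>

lemma no_recurrent_curve:
  fixes x :: "real \<Rightarrow> complex" and g :: "complex \<Rightarrow> complex"
  assumes deriv: "\<And>t. t \<ge> 0 \<Longrightarrow> (x has_vector_derivative exp (g (x t))) (at t within {0..})"
    and contg: "continuous_on N g" and inN: "\<And>t. t \<ge> 0 \<Longrightarrow> x t \<in> N"
    and low: "\<And>t. t \<ge> 0 \<Longrightarrow> Im (x 1) \<le> Im (x t)"
    and right: "Re (exp (g (x 1))) \<ge> 0"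
    and inj: "\<And>s t r. 0 \<le> r \<Longrightarrow> r \<le> s \<Longrightarrow> s \<le> t \<Longrightarrow> x s = x t \<Longrightarrow> x (s - r) = x (t - r)"
    and recurrent: "\<And>\<delta>. \<delta> > 0 \<Longrightarrow> \<exists>\<tau>\<ge>2. \<forall>s\<in>{0..2}. dist (x (s + \<tau>)) (x s) < \<delta>"
  shows False
proof -
  define q where "q = x 1"
  define w where "w t = g (x t)" for t
  have contx: "continuous_on {0..} x"
    using deriv by (auto simp: continuous_on_eq_continuous_within intro: has_vector_derivative_continuous)
  have contw: "continuous_on {0..} w"
    unfolding w_def by (rule continuous_on_compose2[OF contg contx]) (use inN in auto)
  have dw: "(x has_vector_derivative exp (w t)) (at t within {0..})" if "t \<ge> 0" for t
    using deriv[OF that] by (simp add: w_def)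
  have Im0: "Im (exp (w 1)) = 0"
  proof -
    have "(x has_vector_derivative exp (w 1)) (at 1)"
      using dw[of 1] at_within_interior[of "1::real" "{0..}"] by (simp add: interior_real_atLeast)
    from bounded_linear.has_vector_derivative[OF bounded_linear_Im this]
    have d: "((\<lambda>t. Im (x t)) has_real_derivative Im (exp (w 1))) (at 1)"
      by (simp add: has_real_derivative_iff_has_vector_derivative)
    show ?thesis
      by (rule DERIV_local_min[OF d, of 1]) (use low in \<open>auto simp: abs_if split: if_splits\<close>)
  qed
  \<comment> \<open>The velocity at the lowest point is a positive real number.\<close>
  have sin0: "sin (Im (w 1)) = 0" using Im0 by (simp add: Im_exp)
  have cos0: "cos (Im (w 1)) = 1"
  proof -
    have "cos (Im (w 1)) \<ge> 0" using right by (simp add: Re_exp w_def zero_le_mult_iff)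
    moreover have "cos (Im (w 1)) ^ 2 = 1" using sin_cos_squared_add[of "Im (w 1)"] sin0 by simp
    ultimately show ?thesis by (simp add: power2_eq_1_iff)
  qed
  have qN: "q \<in> N" using inN[of 1] by (simp add: q_def)
  \<comment> \<open>In the disc of radius \<open>\<rho>\<close> about \<open>q\<close> the curve moves to the right.\<close>
  obtain \<rho> where \<rho>: "\<rho> > 0" "\<And>z. z \<in> N \<Longrightarrow> dist z q < \<rho> \<Longrightarrow> dist (g z) (g q) < pi/2"
    using contg qN pi_gt_zero unfolding continuous_on_iff by (metis half_gt_zero)
  have ang: "\<bar>Im (w t) - Im (w 1)\<bar> < pi/2" if "t \<ge> 0" "dist (x t) q < \<rho>" for t
  proof -
    have "\<bar>Im (w t - w 1)\<bar> < pi/2"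
      using \<rho>(2)[OF inN that(2)] that(1) abs_Im_le_cmod[of "w t - w 1"]
      unfolding w_def q_def dist_norm by linarith
    then show ?thesis by simp
  qed
  have Repos: "Re (exp (w t)) > 0" if "t \<ge> 0" "dist (x t) q < \<rho>" for t
  proof -
    have "cos (Im (w t)) = cos (Im (w t) - Im (w 1))" by (simp add: cos_diff sin0 cos0)
    also have "\<dots> > 0" using ang[OF that] by (intro cos_gt_zero_pi) linarith+
    finally show ?thesis by (simp add: Re_exp)
  qed
  have incr: "Re (x a) < Re (x b)" if "0 \<le> a" "a < b" "\<And>t. t \<in> {a..b} \<Longrightarrow> dist (x t) q < \<rho>" for a b
    using that by (intro strictly_increasing_Re[of a b x "\<lambda>t. exp (w t)"] dw Repos) auto
  have near: "\<exists>e>0. e \<le> e0 \<and> (\<forall>t\<in>{t0-e..t0+e}. dist (x t) q < r)"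
    if prem: "t0 > 0" "dist (x t0) q < r" "e0 > 0" for t0 r e0
  proof -
    have "continuous (at t0) x"
    proof -
      have "continuous (at t0 within {0..}) x"
        using contx prem(1) by (auto simp: continuous_on_eq_continuous_within)
      then show ?thesis using prem(1) at_within_interior[of t0 "{0..}"] by (simp add: interior_real_atLeast)
    qed
    then obtain d where d: "d > 0" "\<And>t. dist t t0 < d \<Longrightarrow> dist (x t) (x t0) < r - dist (x t0) q"
      using prem(2) unfolding continuous_at_eps_delta by (metis diff_gt_0_iff_gt)
    have "dist (x t) q < r" if "t \<in> {t0 - min e0 (d/2)..t0 + min e0 (d/2)}" for t
    proof -
      have "dist t t0 < d" using that d(1) by (auto simp: dist_real_def)
      from d(2)[OF this] show ?thesis using dist_triangle[of "x t" q "x t0"] by linarith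
    qed
    then show ?thesis using d(1) prem(3) by (intro exI[of _ "min e0 (d/2)"]) auto
  qed
  obtain \<epsilon> where eps: "\<epsilon> > 0" "\<epsilon> \<le> 1/2" "\<And>t. t \<in> {1-\<epsilon>..1+\<epsilon>} \<Longrightarrow> dist (x t) q < \<rho>/2"
    using near[of 1 "\<rho>/2" "1/2"] \<rho>(1) by (auto simp: q_def)
  have eps': "dist (x t) q < \<rho>" if "t \<in> {1-\<epsilon>..1+\<epsilon>}" for t using eps(3)[OF that] \<rho>(1) by linarith
  have lt: "Re (x (1-\<epsilon>)) < Re q" unfolding q_def
    by (rule incr) (use eps(1,2) in \<open>auto intro!: eps'\<close>)
  have gt: "Re q < Re (x s)" if "1 < s" "s \<le> 1 + \<epsilon>" for s unfolding q_def
    by (rule incr) (use that eps(1,2) in \<open>auto intro!: eps'\<close>)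
  define \<delta> where "\<delta> = min (\<rho>/2) (min (Re q - Re (x (1-\<epsilon>))) (Re (x (1+\<epsilon>)) - Re q))"
  have \<delta>: "\<delta> > 0" using lt gt[of "1+\<epsilon>"] eps(1) \<rho>(1) by (auto simp: \<delta>_def)
  \<comment> \<open>Recurrence makes the curve cross the vertical line through \<open>q\<close> again inside the disc, at
    some time \<open>T'\<close>.\<close>
  obtain \<tau> where \<tau>: "\<tau> \<ge> 2" "\<And>s. s \<in> {0..2} \<Longrightarrow> dist (x (s + \<tau>)) (x s) < \<delta>" using recurrent[OF \<delta>] by blast
  have Red: "\<bar>Re (x (s+\<tau>)) - Re (x s)\<bar> < \<delta>" if "s \<in> {0..2}" for s
    using \<tau>(2)[OF that] abs_Re_le_cmod[of "x (s+\<tau>) - x s"] by (simp add: dist_norm)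
  have "\<exists>s. 1 - \<epsilon> \<le> s \<and> s \<le> 1 + \<epsilon> \<and> Re (x (s + \<tau>)) = Re q"
  proof (rule IVT')
    show "Re (x (1 - \<epsilon> + \<tau>)) \<le> Re q" using Red[of "1-\<epsilon>"] eps(1,2) by (auto simp: \<delta>_def)
    show "Re q \<le> Re (x (1 + \<epsilon> + \<tau>))" using Red[of "1+\<epsilon>"] eps(1,2) by (auto simp: \<delta>_def)
    show "1 - \<epsilon> \<le> 1 + \<epsilon>" using eps by simp
    show "continuous_on {1-\<epsilon>..1+\<epsilon>} (\<lambda>s. Re (x (s+\<tau>)))"
      by (intro continuous_intros continuous_on_compose2[OF contx]) (use eps \<tau>(1) in auto)
  qed
  then obtain s0 where s0: "1 - \<epsilon> \<le> s0" "s0 \<le> 1 + \<epsilon>" "Re (x (s0 + \<tau>)) = Re q" by blast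
  define T' where "T' = s0 + \<tau>"
  have T'1: "T' > 1 + \<epsilon>" using s0 \<tau>(1) eps(1,2) by (auto simp: T'_def)
  have T'2: "Re (x T') = Re q" using s0 by (simp add: T'_def)
  have T'3: "dist (x T') q < \<rho>"
    using \<tau>(2)[of s0] eps(3)[of s0] s0(1,2) eps(1,2) dist_triangle[of "x T'" q "x s0"]
    by (auto simp: T'_def \<delta>_def)
  \<comment> \<open>Among the crossings after time \<open>1\<close> and up to \<open>T'\<close> let \<open>T\<close> be the first of the lowest ones. Then between \<open>1\<close> and
    \<open>T\<close> the curve meets the vertical line only strictly above \<open>x T\<close>. If
    the curve has come back to \<open>q\<close> itself by then, \<open>T\<close> is the first return to \<open>q\<close>.\<close>
  define R where "R = {t \<in> {1+\<epsilon>..T'}. Re (x t) = Re q}"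
  have contx2: "continuous_on {1+\<epsilon>..T'} x" by (rule continuous_on_subset[OF contx]) (use eps in auto)
  have contR: "continuous_on {1+\<epsilon>..T'} (\<lambda>t. Re (x t))" "continuous_on {1+\<epsilon>..T'} (\<lambda>t. Im (x t))"
    by (intro continuous_intros contx2)+
  have "closed R" 
    using continuous_closed_preimage_constant[OF contR(1), of "Re q"] by (simp add: R_def)
  moreover have "bounded R" by (rule bounded_subset[of "{1+\<epsilon>..T'}"]) (auto simp: R_def)
  ultimately have "compact R" by (simp add: compact_eq_bounded_closed)
  moreover have "T' \<in> R" using T'1 T'2 by (simp add: R_def)
  moreover have contIR: "continuous_on R (\<lambda>t. Im (x t))"
    by (rule continuous_on_subset[OF contR(2)]) (auto simp: R_def)
  ultimately obtain T0 where T0: "T0 \<in> R" "\<And>t. t \<in> R \<Longrightarrow> Im (x T0) \<le> Im (x t)"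
    using continuous_attains_inf[of R "\<lambda>t. Im (x t)"] by blast
  define R0 where "R0 = {t \<in> R. Im (x t) = Im (x T0)}"
  have "closed R0" 
    using continuous_closed_preimage_constant[OF contIR \<open>closed R\<close>] by (simp add: R0_def)
  moreover have "bounded R0" by (rule bounded_subset[OF \<open>bounded R\<close>]) (auto simp: R0_def)
  ultimately have "compact R0" by (simp add: compact_eq_bounded_closed)
  moreover have "T0 \<in> R0" using T0 by (simp add: R0_def)
  ultimately obtain T where T: "T \<in> R0" "\<And>t. t \<in> R0 \<Longrightarrow> T \<le> t"
    using continuous_attains_inf[of R0 "\<lambda>t. t"] by auto
  have ReT: "Re (x T) = Re q" and Tge: "T \<ge> 1 + \<epsilon>" and ImT': "Im (x T) \<le> Im (x T')"
    using T(1) T0(2)[OF \<open>T' \<in> R\<close>] by (auto simp: R0_def R_def)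
  have lowT: "Im q \<le> Im (x T)" using low[of T] Tge eps by (simp add: q_def)
  have distq: "dist z q = \<bar>Im z - Im q\<bar>" if "Re z = Re q" for z
    using that by (simp add: dist_norm cmod_def)
  have distT: "dist (x T) q < \<rho>"
    using distq[OF ReT] distq[OF T'2] T'3 ImT' lowT by linarith
  have above: "Im (x T) < Im (x s)" if "1 < s" "s < T" "Re (x s) = Re q" for s
  proof -
    have "1 + \<epsilon> < s" using gt[of s] that by force
    moreover have "T \<le> T'" using T(1) by (auto simp: R0_def R_def)
    ultimately have "s \<in> R" using that by (auto simp: R_def)
    moreover have "s \<notin> R0" using T(2)[of s] that by auto
    ultimately show ?thesis using T0(2)[of s] T(1) by (auto simp: R0_def)
  qed
  have T1: "T > 1 + \<epsilon>" using Tge gt[of "1+\<epsilon>"] eps(1) ReT by (cases "T = 1 + \<epsilon>") auto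
  have nocross: "x s \<noteq> x t" if "1 \<le> s" "s < t" "t \<le> T" "\<not> (s = 1 \<and> t = T)" for s t
  proof
    assume eq: "x s = x t"
    show False
    proof (cases "t = T")
      case True
      then have "1 < s" using that by force
      then show False using above[of s] eq that True ReT by auto
    next
      case False
      have "x (s - (s - 1)) = x (t - (s - 1))" using inj[of "s-1" s t] that eq by simp
      then have "x (1 + (t - s)) = q" by (simp add: q_def algebra_simps)
      then show False using above[of "1 + (t - s)"] that False lowT by auto
    qed
  qed
  obtain \<eta> where eta: "\<eta> > 0" "\<eta> \<le> min \<epsilon> ((T - 1)/3)" "\<And>t. t \<in> {T-\<eta>..T+\<eta>} \<Longrightarrow> dist (x t) q < \<rho>"
    using near[of T \<rho> "min \<epsilon> ((T - 1)/3)"] distT T1 eps(1) by auto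
  have eta': "\<eta> \<le> \<epsilon>" "3 * \<eta> \<le> T - 1" using eta(2) by auto
  have ltT: "Re (x s) < Re q" if "T - \<eta> \<le> s" "s < T" for s
    unfolding ReT[symmetric] by (rule incr) (use that eta eta' eps(1) in auto)
  \<comment> \<open>\<open>C (s, t)\<close> is the chord divided by \<open>t - s\<close>, extended by the velocity on the diagonal. The
    trapezoid \<open>S\<close> leaves out the corner \<open>(1, T)\<close>, where the chord may vanish.\<close>
  define S where "S = {p::real\<times>real. 1 \<le> fst p \<and> fst p \<le> snd p \<and> snd p \<le> T \<and> snd p - fst p \<le> T - 1 - \<eta>}"
  define C where "C p = integral (cbox 0 1) (\<lambda>u. exp (w (fst p + u * (snd p - fst p))))" for p
  have "convex S"
  proof -
    have "S = {p. inner (-1, 0) p \<le> -1} \<inter> {p. inner (1,-1) p \<le> 0} \<inter> {p. inner (0,1) p \<le> T} \<inter> {p. inner (-1,1) p \<le> T - 1 - \<eta>}"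
      by (auto simp: S_def inner_prod_def)
    then show ?thesis by (simp only:) (intro convex_Int convex_halfspace_le)
  qed
  have inside: "fst p + u * (snd p - fst p) \<ge> 0" if "p \<in> S" "u \<in> {0..1}" for p u
    using that by (auto simp: S_def)
  have contC: "continuous_on S C"
    unfolding C_def
    by (intro integral_continuous_on_param) 
      (auto simp: split_beta intro!: continuous_intros continuous_on_compose2[OF contw] inside)
  have C_eq: "(t - s) *\<^sub>R C (s, t) = x t - x s" if "(s, t) \<in> S" for s t
  proof -
    have "((\<lambda>u. (t - s) *\<^sub>R exp (w (s + u * (t - s)))) has_integral x (s + 1 * (t - s)) - x (s + 0 * (t - s))) {0..1}"
    proof (rule fundamental_theorem_of_calculus)
      fix u :: real assume u: "u \<in> {0..1}"
      have "((x \<circ> (\<lambda>u. s + u * (t - s))) has_vector_derivative (t - s) *\<^sub>R exp (w (s + u * (t - s)))) (at u within {0..1})"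
      proof (rule vector_diff_chain_within)
        show "((\<lambda>u. s + u * (t - s)) has_vector_derivative t - s) (at u within {0..1})"
          by (auto intro!: derivative_eq_intros simp: has_real_derivative_iff_has_vector_derivative[symmetric])
        show "(x has_vector_derivative exp (w (s + u * (t - s)))) (at (s + u * (t - s)) within (\<lambda>u. s + u * (t - s)) ` {0..1})"
          by (rule has_vector_derivative_within_subset[OF dw]) (use inside[OF that] u in auto)
      qed
      then show "((\<lambda>u. x (s + u * (t - s))) has_vector_derivative (t - s) *\<^sub>R exp (w (s + u * (t - s)))) (at u within {0..1})"
        by (simp add: o_def)
    qed simp
    then have "integral (cbox 0 1) (\<lambda>u. (t - s) *\<^sub>R exp (w (s + u * (t - s)))) = x t - x s"
      by (intro integral_unique) simp
    then show ?thesis by (simp only: C_def integral_cmul fst_conv snd_conv)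
  qed
  have C_diag: "C (t, t) = exp (w t)" for t by (simp add: C_def)
  have C_nz: "C p \<noteq> 0" if "p \<in> S" for p
  proof (cases "fst p = snd p")
    case True
    then show ?thesis using C_diag[of "snd p"] by (metis exp_not_eq_zero prod.collapse)
  next
    case False
    have "x (fst p) \<noteq> x (snd p)"
      by (rule nocross) (use that False eta in \<open>auto simp: S_def\<close>)
    then show ?thesis using C_eq[of "fst p" "snd p"] that by auto
  qed
  obtain l where l: "continuous_on S l" "\<And>p. p \<in> S \<Longrightarrow> C p = exp (l p)"
    using continuous_logarithm_on_contractible[OF contC convex_imp_contractible[OF \<open>convex S\<close>] C_nz] by metis
  \<comment> \<open>\<open>\<Theta>\<close> is the argument of the chord, normalised to vanish at the initial tangent.\<close>
  define \<Theta> where "\<Theta> p = Im (l p) - Im (w 1) - Im (l (1,1) - w 1)" for p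
  have diagS: "(t, t) \<in> S" if "t \<in> {1..T}" for t using that eta' T1 eta(1) by (auto simp: S_def)
  \<comment> \<open>On the diagonal two logarithms of the velocity are compared, so they differ by a constant.\<close>
  have "(\<lambda>t. l (t,t) - w t) constant_on {1..T}"
  proof (rule continuous_discrete_range_constant)
    show "continuous_on {1..T} (\<lambda>t. l (t,t) - w t)"
      by (intro continuous_intros continuous_on_compose2[OF l(1)] continuous_on_subset[OF contw])
        (auto intro: diagS)
    fix t assume t: "t \<in> {1..T}"
    have e: "exp (l (u,u) - w u) = 1" if "u \<in> {1..T}" for u
      using l(2)[OF diagS[OF that]] C_diag[of u] by (simp add: exp_diff)
    show "\<exists>e>0. \<forall>u. u \<in> {1..T} \<and> l (u,u) - w u \<noteq> l (t,t) - w t \<longrightarrow> e \<le> norm ((l (u,u) - w u) - (l (t,t) - w t))"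
    proof (intro exI[of _ "2*pi"] conjI allI impI)
      fix u assume u: "u \<in> {1..T} \<and> l (u,u) - w u \<noteq> l (t,t) - w t"
      then have "exp ((l (u,u) - w u) - (l (t,t) - w t)) = 1" using e[of u] e[OF t] by (simp add: exp_diff)
      then obtain n :: int where n: "(l (u,u) - w u) - (l (t,t) - w t) = (of_int (2 * n) * pi) * \<i>"
        using exp_eq[of "(l (u,u) - w u) - (l (t,t) - w t)" 0] by (auto simp: mult.commute)
      have "n \<noteq> 0" using u n by auto
      then have "\<bar>real_of_int n\<bar> \<ge> 1" by linarith
      then have "2 * pi \<le> \<bar>real_of_int n\<bar> * (2 * pi)" by simp
      then show "2 * pi \<le> norm ((l (u,u) - w u) - (l (t,t) - w t))"
        unfolding n by (simp add: norm_mult abs_mult mult_ac)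
    qed auto
  qed simp
  then have "l (T,T) - w T = l (1,1) - w 1"
    unfolding constant_on_def using T1 eps(1) by fastforce
  then have Theta_T: "\<Theta> (T,T) = Im (w T) - Im (w 1)" by (simp add: \<Theta>_def complex_eq_iff)
  have Theta_1: "\<Theta> (1,1) = 0" by (simp add: \<Theta>_def)
  have exp11: "exp (l (1,1)) = exp (w 1)" using l(2)[OF diagS[of 1]] C_diag[of 1] T1 eps by simp
  have sc: "sin (Im (l (1,1))) = 0" "cos (Im (l (1,1))) = 1"
  proof -
    have "exp (l (1,1)) = of_real (exp (Re (w 1)))"
      unfolding exp11 by (simp add: complex_eq_iff Re_exp Im_exp sin0 cos0)
    then have "exp (Re (l (1,1))) = exp (Re (w 1))" by (metis norm_exp_eq_Re exp11)
    then show "sin (Im (l (1,1))) = 0" "cos (Im (l (1,1))) = 1"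
      using \<open>exp (l (1,1)) = of_real (exp (Re (w 1)))\<close> by (auto simp: complex_eq_iff Re_exp Im_exp)
  qed
  have ReC: "Re (C p) = exp (Re (l p)) * cos (\<Theta> p)" and ImC: "Im (C p) = exp (Re (l p)) * sin (\<Theta> p)" if "p \<in> S" for p
    using l(2)[OF that] by (auto simp: \<Theta>_def Re_exp Im_exp cos_diff sin_diff sc)
  have contT: "continuous_on S \<Theta>" unfolding \<Theta>_def by (intro continuous_intros l(1))
  \<comment> \<open>Chords from \<open>q\<close> never point downwards, as \<open>q\<close> is lowest.\<close>
  have leg1: "\<Theta> (1, T - \<eta>) > - (pi/2)"
  proof (rule stays_above[where h = "\<lambda>t. \<Theta> (1,t)" and a = 1])
    have S1: "(1, t) \<in> S" if "t \<in> {1..T-\<eta>}" for t using that eta by (auto simp: S_def)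
    show "continuous_on {1..T-\<eta>} (\<lambda>t. \<Theta> (1,t))"
      by (intro continuous_intros continuous_on_compose2[OF contT]) (auto intro: S1)
    fix t assume t: "t \<in> {1..T-\<eta>}"
    show "\<Theta> (1,t) \<noteq> - (pi/2)"
    proof
      assume "\<Theta> (1,t) = - (pi/2)"
      then have neg: "Im (C (1,t)) < 0" using ImC[OF S1[OF t]] by simp
      moreover have "(t - 1) * Im (C (1,t)) = Im (x t) - Im (x 1)"
        using arg_cong[OF C_eq[OF S1[OF t]], of Im] by simp
      moreover have "Im (x 1) \<le> Im (x t)" using low t by auto
      ultimately have "(t - 1) * Im (C (1,t)) \<ge> 0" by simp
      then have "t = 1" using neg t by (auto simp: zero_le_mult_iff)
      then show False using neg Theta_1 \<open>\<Theta> (1,t) = - (pi/2)\<close> pi_gt_zero by simp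
    qed
  qed (use eta eta' Theta_1 in auto)
  \<comment> \<open>Both ends of the chord now move on by \<open>\<eta>\<close>; meanwhile it points to the left.\<close>
  have S2: "(1 + u, T - \<eta> + u) \<in> S" if "u \<in> {0..\<eta>}" for u using that eta' eta(1) by (auto simp: S_def)
  have neg2: "cos (\<Theta> (1 + u, T - \<eta> + u)) < 0" if u: "u \<in> {0..\<eta>}" for u
  proof -
    have a: "Re (x (T - \<eta> + u)) \<le> Re q" "u < \<eta> \<Longrightarrow> Re (x (T - \<eta> + u)) < Re q"
      using ltT[of "T - \<eta> + u"] ReT u by (cases "u = \<eta>", auto)+
    have b: "Re q \<le> Re (x (1 + u))" "u > 0 \<Longrightarrow> Re q < Re (x (1 + u))"
      using gt[of "1+u"] u eta' by (cases "u = 0", auto simp: q_def)+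
    have c: "Re (x (T - \<eta> + u)) < Re (x (1 + u))" using a b u eta(1) by (cases "u < \<eta>") auto
    have "(T - \<eta> - 1) * Re (C (1 + u, T - \<eta> + u)) = Re (x (T - \<eta> + u)) - Re (x (1 + u))"
      using arg_cong[OF C_eq[OF S2[OF u]], of Re] by simp
    then have "(T - \<eta> - 1) * Re (C (1 + u, T - \<eta> + u)) < 0" using c by simp
    then have "Re (C (1 + u, T - \<eta> + u)) < 0" using eta' eta(1) by (auto simp: mult_less_0_iff)
    then show ?thesis using ReC[OF S2[OF u]] by (auto simp: mult_less_0_iff)
  qed
  have "\<Theta> (1, T - \<eta>) > pi/2"
    using neg2[of 0] leg1 cos_ge_zero[of "\<Theta> (1, T - \<eta>)"] eta(1) by fastforce
  have "\<Theta> (1 + \<eta>, T - \<eta> + \<eta>) > pi/2"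
  proof (rule stays_above[where h = "\<lambda>u. \<Theta> (1 + u, T - \<eta> + u)" and a = 0])
    show "continuous_on {0..\<eta>} (\<lambda>u. \<Theta> (1 + u, T - \<eta> + u))"
      by (intro continuous_intros continuous_on_compose2[OF contT]) (use S2 in auto)
    show "\<Theta> (1 + u, T - \<eta> + u) \<noteq> pi/2" if "u \<in> {0..\<eta>}" for u
      using neg2[OF that] by (metis cos_pi_half order.irrefl)
  qed (use \<open>\<Theta> (1, T - \<eta>) > pi/2\<close> eta(1) in auto)
  then have leg2: "\<Theta> (1 + \<eta>, T) > pi/2" by simp
  \<comment> \<open>Chords ending at \<open>x T\<close> never point vertically upwards, by the choice of \<open>T\<close>.\<close>
  have "\<Theta> (T, T) > pi/2"
  proof (rule stays_above[where h = "\<lambda>s. \<Theta> (s,T)" and a = "1 + \<eta>"])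
    have S3: "(s, T) \<in> S" if "s \<in> {1+\<eta>..T}" for s using that eta by (auto simp: S_def)
    show "continuous_on {1+\<eta>..T} (\<lambda>s. \<Theta> (s,T))"
      by (intro continuous_intros continuous_on_compose2[OF contT]) (auto intro: S3)
    fix s assume s: "s \<in> {1+\<eta>..T}"
    show "\<Theta> (s,T) \<noteq> pi/2"
    proof
      assume eq: "\<Theta> (s,T) = pi/2"
      then have C: "Re (C (s,T)) = 0" "Im (C (s,T)) > 0" using ReC[OF S3[OF s]] ImC[OF S3[OF s]] unfolding eq by auto
      have "s \<noteq> T" using C(1) Repos[of T] distT C_diag[of T] T1 eps(1) by auto
      then have "(T - s) * Im (C (s,T)) > 0" "(T - s) * Re (C (s,T)) = 0" using C s by auto
      then have "Im (x T) > Im (x s)" "Re (x T) = Re (x s)"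
        using arg_cong[OF C_eq[OF S3[OF s]], of Im] arg_cong[OF C_eq[OF S3[OF s]], of Re] by auto
      then show False using above[of s] s \<open>s \<noteq> T\<close> eta(1) ReT by auto
    qed
  qed (use leg2 eta' eta(1) in auto)
  moreover have "\<bar>Im (w T) - Im (w 1)\<bar> < pi/2" using ang[of T] distT T1 eps(1) by simp
  ultimately show False using Theta_T by linarith
qed

section \<open>Area and fields of positive divergence\<close>

lemma cball_nbhd_eq_sums:
  fixes K :: "'a::real_normed_vector set"
  shows "(\<Union>x\<in>K. cball x \<delta>) = (\<Union>x\<in>K. \<Union>y\<in>cball 0 \<delta>. {x + y})"
proof -
  have "cball x \<delta> = (\<Union>y\<in>cball 0 \<delta>. {x + y})" for x :: 'a
    using cball_translation[of x 0 \<delta>] by (simp only: image_def) auto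
  then show ?thesis by (rule SUP_cong[OF refl])
qed

lemma compact_cball_nbhd:
  fixes K :: "'a::euclidean_space set"
  assumes "compact K"
  shows "compact (\<Union>x\<in>K. cball x \<delta>)"
  unfolding cball_nbhd_eq_sums by (rule compact_sums'[OF assms compact_cball])

lemma convex_cball_nbhd:
  fixes K :: "'a::real_normed_vector set"
  assumes "convex K"
  shows "convex (\<Union>x\<in>K. cball x \<delta>)"
  unfolding cball_nbhd_eq_sums by (rule convex_sums[OF assms convex_cball])

lemma onorm_matrix_le:
  fixes A :: "real^'n^'n"
  shows "onorm ((*v) A) \<le> real (CARD('n)) * real (CARD('n)) * norm A"
proof (rule onorm_le_matrix_component)
  fix i j
  show "\<bar>A $ i $ j\<bar> \<le> norm A"
    by (rule order_trans[OF component_le_norm_cart Finite_Cartesian_Product.norm_nth_le])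
qed

text \<open>
  The determinant of the derivative of the Euler step \<open>x \<mapsto> x + h X x\<close> is
  \<open>1 + h div X + h\<^sup>2 det J\<close>; a lower bound for it bounds the growth of area from below.
\<close>

lemma euler_step_measure:
  fixes X :: "real^2 \<Rightarrow> real^2" and J :: "real^2 \<Rightarrow> real^2^2"
  assumes X': "\<And>x. x \<in> S \<Longrightarrow> (X has_derivative (*v) (J x)) (at x)"
    and S: "compact S" and h: "h \<ge> 0" and q: "q \<ge> 0"
    and det: "\<And>x. x \<in> S \<Longrightarrow> q \<le> 1 + h * (J x $ 1 $ 1 + J x $ 2 $ 2) + h\<^sup>2 * det (J x)"
    and inj: "inj_on (\<lambda>x. x + h *\<^sub>R X x) S"
  shows "q * measure lebesgue S \<le> measure lebesgue ((\<lambda>x. x + h *\<^sub>R X x) ` S)"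
proof -
  let ?E = "\<lambda>x. x + h *\<^sub>R X x"
  let ?E' = "\<lambda>x v. v + h *\<^sub>R (J x *v v)"
  have E': "(?E has_derivative ?E' x) (at x within S)" if "x \<in> S" for x
    by (rule has_derivative_add[OF has_derivative_ident
          has_derivative_scaleR_right[OF has_derivative_at_withinI[OF X'[OF that]]]])
  have mat: "det (matrix (?E' x)) = 1 + h * (J x $ 1 $ 1 + J x $ 2 $ 2) + h\<^sup>2 * det (J x)" for x
    by (simp add: det_2 matrix_def axis_def matrix_vector_mult_def UNIV_2 algebra_simps power2_eq_square)
  have contE: "continuous_on S ?E"
    using E' by (meson has_derivative_continuous_on)
  have lS: "S \<in> lmeasurable" and lE: "?E ` S \<in> lmeasurable"
    using S compact_continuous_image[OF contE S] by (auto intro: lmeasurable_compact)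
  have sS: "S \<in> sets lebesgue" using lS by (simp add: fmeasurableD)
  have int: "(\<lambda>x. \<bar>det (matrix (?E' x))\<bar>) integrable_on S"
    using measurable_differentiable_image_eq[OF sS E' inj] lE by simp
  have "q * measure lebesgue S = integral S (\<lambda>x. q * 1)"
    using lmeasure_integral[OF lS] by (simp only: integral_mult_right)
  also have "\<dots> \<le> integral S (\<lambda>x. \<bar>det (matrix (?E' x))\<bar>)"
    by (rule integral_le) (use integrable_on_const[OF lS, of q] int det mat in \<open>auto intro: order_trans[OF _ abs_ge_self]\<close>)
  also have "\<dots> = measure lebesgue (?E ` S)"
    using measure_differentiable_image_eq[OF sS E' inj int] by simp
  finally show ?thesis .
qed

text \<open>
  A compact set \<open>A\<close> that is carried into itself, in time \<open>t\<close>, by solution curves of a field with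
  positive divergence has measure zero. Differentiability of a flow with respect to the initial
  point is not needed: \<open>n\<close> Euler steps of length \<open>t/n\<close> expand the area of \<open>A\<close> by a factor of at
  least \<open>1 + c t / 2\<close>, where \<open>c\<close> bounds the divergence from below, and for large \<open>n\<close> they map \<open>A\<close>
  into an arbitrarily small neighbourhood of \<open>A\<close>.
\<close>

lemma expanding_field_null_set:
  fixes X :: "real^2 \<Rightarrow> real^2" and J :: "real^2 \<Rightarrow> real^2^2"
  assumes D: "open D" and X': "\<And>x. x \<in> D \<Longrightarrow> (X has_derivative (*v) (J x)) (at x)"
    and contJ: "continuous_on D J"
    and div: "\<And>x. x \<in> D \<Longrightarrow> J x $ 1 $ 1 + J x $ 2 $ 2 > 0"
    and K: "compact K" "convex K" "K \<subseteq> D"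
    and A: "compact A" and t: "t > 0"
    and flow: "\<And>y. y \<in> A \<Longrightarrow> \<exists>\<psi>. \<psi> 0 = y \<and> \<psi> t \<in> A \<and>
        (\<forall>s\<in>{0..t}. \<psi> s \<in> K \<and> (\<psi> has_vector_derivative X (\<psi> s)) (at s within {0..t}))"
  shows "measure lebesgue A = 0"
proof (cases "A = {}")
  case False
  have AK: "A \<subseteq> K"
  proof
    fix y assume "y \<in> A"
    from flow[OF this] obtain \<psi> where "\<psi> 0 = y" "\<psi> 0 \<in> K" using t by force
    then show "y \<in> K" by simp
  qed
  obtain \<delta> where \<delta>: "\<delta> > 0" "(\<Union>x\<in>K. cball x \<delta>) \<subseteq> D"
    using compact_subset_open_imp_cball_epsilon_subset[OF K(1) D K(3)] by blast
  \<comment> \<open>Euler polygons may leave \<open>K\<close>, but they stay in the compact convex neighbourhood \<open>W\<close>.\<close>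
  define W where "W = (\<Union>x\<in>K. cball x \<delta>)"
  have W: "compact W" "convex W" "W \<subseteq> D"
    using compact_cball_nbhd[OF K(1)] convex_cball_nbhd[OF K(2)] \<delta> by (auto simp: W_def)
  have KW: "K \<subseteq> W" using \<delta>(1) by (auto simp: W_def)
  have Wne: "W \<noteq> {}" using False AK KW by auto
  have XW: "(X has_derivative (*v) (J x)) (at x)" if "x \<in> W" for x using X' W(3) that by blast
  have contJW: "continuous_on W J" using contJ W(3) continuous_on_subset by blast
  have contXW: "continuous_on W X"
    using XW by (meson has_derivative_at_withinI has_derivative_continuous_on)
  obtain L0 where L0: "\<And>x. x \<in> W \<Longrightarrow> norm (J x) \<le> L0"
    using compact_imp_bounded[OF compact_continuous_image[OF contJW W(1)]] by (auto simp: bounded_iff)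
  define L where "L = \<bar>4 * L0\<bar> + 1"
  have L: "L > 0" "\<And>x. x \<in> W \<Longrightarrow> onorm ((*v) (J x)) \<le> L"
  proof -
    show "L > 0" by (simp add: L_def)
    fix x assume "x \<in> W"
    then show "onorm ((*v) (J x)) \<le> L"
      using onorm_matrix_le[of "J x"] L0[of x] by (simp add: L_def)
  qed
  have lip: "norm (X x - X y) \<le> L * norm (x - y)" if "x \<in> W" "y \<in> W" for x y
    by (rule differentiable_bound[OF W(2) has_derivative_at_withinI[OF XW] L(2)]) (use that in auto)
  obtain V where V: "V > 0" "\<And>x. x \<in> W \<Longrightarrow> norm (X x) \<le> V"
    using compact_imp_bounded[OF compact_continuous_image[OF contXW W(1)]] by (auto simp: bounded_pos)
  have contdiv: "continuous_on W (\<lambda>x. J x $ 1 $ 1 + J x $ 2 $ 2)"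
    by (intro continuous_intros contJW)
  obtain c where c: "c > 0" "\<And>x. x \<in> W \<Longrightarrow> c \<le> J x $ 1 $ 1 + J x $ 2 $ 2"
    using continuous_attains_inf[OF W(1) Wne contdiv] div W(3) by (metis subsetD)
  have contdet: "continuous_on W (\<lambda>x. det (J x))"
    unfolding det_2 by (intro continuous_intros contJW)
  obtain M where M: "M > 0" "\<And>x. x \<in> W \<Longrightarrow> \<bar>det (J x)\<bar> \<le> M"
    using compact_imp_bounded[OF compact_continuous_image[OF contdet W(1)]] by (auto simp: bounded_pos)
  have lA: "A \<in> lmeasurable" using A by (rule lmeasurable_compact)
  have key: "(1 + c * t / 2) * measure lebesgue A \<le> measure lebesgue U"
    if U: "open U" "A \<subseteq> U" "U \<in> lmeasurable" for U
  proof -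
    obtain \<eta> where \<eta>: "\<eta> > 0" "(\<Union>x\<in>A. cball x \<eta>) \<subseteq> U"
      using compact_subset_open_imp_cball_epsilon_subset[OF A U(1,2)] by blast
    define h0 where "h0 = min (1 / (2 * L)) (min (c / (2 * M)) (min \<eta> \<delta> / (V * exp (L * t))))"
    have h0: "h0 > 0" using L c M \<eta> \<delta> V by (simp add: h0_def)
    obtain n :: nat where n: "real n > t / h0" using reals_Archimedean2 by blast
    have n0: "n > 0" using n t h0 by (metis divide_pos_pos of_nat_0_less_iff order_less_trans)
    define h where "h = t / n"
    have h: "h > 0" "h < h0" "n * h = t" 
    proof -
      show "h > 0" "n * h = t" using n0 t by (simp_all add: h_def)
      show "h < h0" using n n0 h0 unfolding h_def
        by (simp add: pos_divide_less_eq mult.commute)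
    qed
    have hL: "h * L < 1" and hM: "h * M < c / 2" and hV: "V * h * exp (L * t) < min \<eta> \<delta>"
    proof -
      have "h < 1 / (2 * L)" "h < c / (2 * M)" "h < min \<eta> \<delta> / (V * exp (L * t))"
        using h(2) by (auto simp: h0_def)
      then show "h * L < 1" "h * M < c / 2" "V * h * exp (L * t) < min \<eta> \<delta>"
        using L(1) M(1) V(1) by (simp_all add: pos_less_divide_eq mult_ac)
    qed
    define E where "E x = x + h *\<^sub>R X x" for x
    have injE: "inj_on E W"
    proof
      fix x y assume xy: "x \<in> W" "y \<in> W" "E x = E y"
      then have "x - y = - (h *\<^sub>R (X x - X y))" by (simp add: E_def algebra_simps add_eq_0_iff)
      then have "norm (x - y) = h * norm (X x - X y)" using h(1) by simp
      also have "\<dots> \<le> h * L * norm (x - y)" using lip[OF xy(1,2)] h(1) by simp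
      finally have "(1 - h * L) * norm (x - y) \<le> 0" by (simp add: algebra_simps)
      then show "x = y" using hL by (auto simp: mult_le_0_iff)
    qed
    \<comment> \<open>The global error of the Euler method is at most \<open>V h (exp (L t) - 1)\<close>.\<close>
    have bnd: "V * h * ((1 + L * h) ^ k - 1) < min \<eta> \<delta>" if "k \<le> n" for k
    proof -
      have "(1 + L * h) ^ k \<le> exp (L * h) ^ k" using L(1) h(1) by (intro power_mono) (use exp_ge_add_one_self[of "L * h"] in auto)
      also have "\<dots> = exp (k * (L * h))" by (simp add: exp_of_nat_mult)
      also have "\<dots> \<le> exp (L * t)"
      proof -
        have "real k * h \<le> t" using that h(1) mult_right_mono[of "real k" "real n" h] unfolding h(3)[symmetric] by simp
        then have "L * (k * h) \<le> L * t" using L(1) by (intro mult_left_mono) auto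
        then show ?thesis by (simp add: mult_ac)
      qed
      finally have "V * h * ((1 + L * h) ^ k - 1) \<le> V * h * exp (L * t)" using V(1) h(1) by (intro mult_left_mono) auto
      then show ?thesis using hV by linarith
    qed
    have step: "real k * h \<in> {0..t}" if "k \<le> n" for k
      using that h(1) mult_right_mono[of "real k" "real n" h] unfolding h(3)[symmetric] by simp
    have err: "norm ((E ^^ k) y - \<psi> (k * h)) \<le> V * h * ((1 + L * h) ^ k - 1)" 
      if psi: "\<psi> 0 = y" "\<And>s. s \<in> {0..t} \<Longrightarrow> \<psi> s \<in> K"
        "\<And>s. s \<in> {0..t} \<Longrightarrow> (\<psi> has_vector_derivative X (\<psi> s)) (at s within {0..t})" and k: "k \<le> n" for k y \<psi>
      using k
    proof (induction k)
      case 0 then show ?case using psi by simp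
    next
      case (Suc k)
      define z where "z = (E ^^ k) y"
      let ?s = "k * h"
      have IH: "norm (z - \<psi> ?s) \<le> V * h * ((1 + L * h) ^ k - 1)" using Suc by (simp add: z_def)
      have s: "?s \<in> {0..t}" "?s + h \<in> {0..t}"
        using step[of k] step[of "Suc k"] Suc.prems by (auto simp: algebra_simps)
      have sub: "{?s..?s+h} \<subseteq> {0..t}" using s by auto
      have "norm (z - \<psi> ?s) < \<delta>" using IH bnd[of k] Suc.prems by linarith
      then have "z \<in> cball (\<psi> ?s) \<delta>" by (simp add: dist_norm norm_minus_commute)
      then have zW: "z \<in> W" using psi(2)[OF s(1)] unfolding W_def by blast
      have psiW: "\<psi> u \<in> W" if "u \<in> {?s..?s+h}" for u using psi(2) sub KW that by blast
      have d: "(\<psi> has_vector_derivative X (\<psi> u)) (at u within {?s..?s+h})" if "u \<in> {?s..?s+h}" for u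
        by (rule has_vector_derivative_within_subset[OF psi(3) sub]) (use sub that in blast)
      have travel: "norm (\<psi> u - \<psi> ?s) \<le> V * h" if u: "u \<in> {?s..?s+h}" for u
      proof -
        have "norm (\<psi> u - \<psi> ?s) \<le> V * norm (u - ?s)"
        proof (rule differentiable_bound[of "{?s..?s+h}" \<psi> "\<lambda>u v. v *\<^sub>R X (\<psi> u)"])
          show "(\<psi> has_derivative (\<lambda>v. v *\<^sub>R X (\<psi> u))) (at u within {?s..?s+h})" if "u \<in> {?s..?s+h}" for u
            using d[OF that] by (simp add: has_vector_derivative_def)
          show "onorm (\<lambda>v. v *\<^sub>R X (\<psi> u)) \<le> V" if "u \<in> {?s..?s+h}" for u
            using V(2)[OF psiW[OF that]] by (intro onorm_le) (auto simp: mult.commute[of V] intro!: mult_left_mono)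
        qed (use u h(1) in auto)
        also have "\<dots> \<le> V * h" using u V(1) by (intro mult_left_mono) auto
        finally show ?thesis .
      qed
      have trunc: "norm (\<psi> (?s + h) - \<psi> ?s - (?s + h - ?s) *\<^sub>R X (\<psi> ?s)) \<le> norm (?s + h - ?s) * (L * (V * h))"
      proof (rule vector_differentiable_bound_linearization[where S = "{?s..?s+h}"])
        show "norm (X (\<psi> u) - X (\<psi> ?s)) \<le> L * (V * h)" if "u \<in> {?s..?s+h}" for u
        proof -
          have "?s \<in> {?s..?s+h}" using h(1) by simp
          then have "norm (X (\<psi> u) - X (\<psi> ?s)) \<le> L * norm (\<psi> u - \<psi> ?s)"
            by (intro lip psiW that)
          also have "\<dots> \<le> L * (V * h)" using travel[OF that] L(1) by (intro mult_left_mono) auto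
          finally show ?thesis .
        qed
      qed (use d h(1) in \<open>auto simp: closed_segment_eq_real_ivl\<close>)
      have "(E ^^ Suc k) y - \<psi> (Suc k * h) = (z - \<psi> ?s) + h *\<^sub>R (X z - X (\<psi> ?s)) - (\<psi> (?s + h) - \<psi> ?s - h *\<^sub>R X (\<psi> ?s))"
        by (simp add: z_def[symmetric] E_def algebra_simps)
      also have "norm \<dots> \<le> norm (z - \<psi> ?s) + h * (L * norm (z - \<psi> ?s)) + h * (L * (V * h))"
      proof -
        have "norm (h *\<^sub>R (X z - X (\<psi> ?s))) \<le> h * (L * norm (z - \<psi> ?s))"
          using lip[OF zW psiW[of ?s]] h(1) by simp
        moreover have "norm (\<psi> (?s + h) - \<psi> ?s - h *\<^sub>R X (\<psi> ?s)) \<le> h * (L * (V * h))"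
          using trunc h(1) by simp
        moreover have "norm (a + b - c) \<le> norm a + norm b + norm c" for a b c :: "real^2"
          using norm_triangle_ineq4[of "a + b" c] norm_triangle_ineq[of a b] by linarith
        ultimately show ?thesis by (smt (verit))
      qed
      also have "\<dots> = (1 + L * h) * norm (z - \<psi> ?s) + L * V * h * h" by (simp add: algebra_simps)
      also have "\<dots> \<le> (1 + L * h) * (V * h * ((1 + L * h) ^ k - 1)) + L * V * h * h"
        using IH L(1) h(1) by (intro add_right_mono mult_left_mono) auto
      also have "\<dots> = V * h * ((1 + L * h) ^ Suc k - 1)" by (simp add: algebra_simps)
      finally show ?case .
    qed
    have track: "\<exists>\<psi>. \<psi> t \<in> A \<and> \<psi> (k * h) \<in> K \<and> norm ((E ^^ k) y - \<psi> (k * h)) < min \<eta> \<delta>"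
      if prem: "k \<le> n" "y \<in> A" for k y
    proof -
      obtain \<psi> where psi: "\<psi> 0 = y" "\<psi> t \<in> A" "\<And>s. s \<in> {0..t} \<Longrightarrow> \<psi> s \<in> K"
        "\<And>s. s \<in> {0..t} \<Longrightarrow> (\<psi> has_vector_derivative X (\<psi> s)) (at s within {0..t})"
        using flow[OF prem(2)] by blast
      have "norm ((E ^^ k) y - \<psi> (k * h)) < min \<eta> \<delta>"
        by (rule order_le_less_trans[OF err bnd[OF prem(1)]]) (use psi prem(1) in auto)
      then show ?thesis using psi step[OF prem(1)] by blast
    qed
    have EW: "(E ^^ k) ` A \<subseteq> W" if kn: "k \<le> n" for k
    proof
      fix z assume "z \<in> (E ^^ k) ` A"
      then obtain \<psi> where "\<psi> (k * h) \<in> K" "norm (z - \<psi> (k * h)) < min \<eta> \<delta>"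
        using track[OF kn] by blast
      then have "\<psi> (k * h) \<in> K" "z \<in> cball (\<psi> (k * h)) \<delta>"
        by (auto simp: dist_norm norm_minus_commute)
      then show "z \<in> W" unfolding W_def by blast
    qed
    have meas: "compact ((E ^^ k) ` A) \<and> (1 + h * c / 2) ^ k * measure lebesgue A \<le> measure lebesgue ((E ^^ k) ` A)" if "k \<le> n" for k
      using that
    proof (induction k)
      case (Suc k)
      let ?S = "(E ^^ k) ` A"
      have IH: "compact ?S" "(1 + h * c / 2) ^ k * measure lebesgue A \<le> measure lebesgue ?S"
        using Suc by auto
      have SW: "?S \<subseteq> W" using EW[of k] Suc.prems by auto
      have eq: "(E ^^ Suc k) ` A = (\<lambda>x. x + h *\<^sub>R X x) ` ?S" by (auto simp: E_def image_image)
      have "compact ((E ^^ Suc k) ` A)"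
        unfolding eq by (intro compact_continuous_image IH(1) continuous_intros continuous_on_subset[OF contXW SW])
      moreover have "(1 + h * c / 2) * measure lebesgue ?S \<le> measure lebesgue ((\<lambda>x. x + h *\<^sub>R X x) ` ?S)"
      proof (rule euler_step_measure[where J = J])
        show "inj_on (\<lambda>x. x + h *\<^sub>R X x) ?S"
          using inj_on_subset[OF injE SW] by (simp add: E_def[abs_def])
        fix x assume "x \<in> ?S"
        then have x: "x \<in> W" using SW by blast
        then show "(X has_derivative (*v) (J x)) (at x)" by (rule XW)
        have "h * (h * - det (J x)) \<le> h * (h * M)" using M(2)[OF x] h(1) by (intro mult_left_mono) auto
        also have "\<dots> \<le> h * (c / 2)" using hM h(1) by (intro mult_left_mono) auto
        finally have 1: "- (h\<^sup>2 * det (J x)) \<le> h * (c / 2)" by (simp add: power2_eq_square)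
        have "h * c \<le> h * (J x $ 1 $ 1 + J x $ 2 $ 2)" using c(2)[OF x] h(1) by (intro mult_left_mono) auto
        then show "1 + h * c / 2 \<le> 1 + h * (J x $ 1 $ 1 + J x $ 2 $ 2) + h\<^sup>2 * det (J x)"
          using 1 by (simp add: field_simps)
      qed (use IH h(1) c(1) in auto)
      moreover have "(1 + h * c / 2) ^ Suc k * measure lebesgue A \<le> (1 + h * c / 2) * measure lebesgue ?S"
        using mult_left_mono[OF IH(2), of "1 + h * c / 2"] h c by (simp add: mult_ac)
      ultimately show ?case unfolding eq by linarith
    qed (use A in auto)
    have "(E ^^ n) ` A \<subseteq> U"
    proof
      fix z assume "z \<in> (E ^^ n) ` A"
      then obtain \<psi> where "\<psi> t \<in> A" "norm (z - \<psi> t) < min \<eta> \<delta>"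
        using track[of n] h(3) by auto
      then show "z \<in> U" using \<eta>(2) by (force simp: dist_norm norm_minus_commute)
    qed
    then have "measure lebesgue ((E ^^ n) ` A) \<le> measure lebesgue U"
      using meas[of n] U(3) by (intro measure_mono_fmeasurable) (auto intro: fmeasurableD lmeasurable_compact)
    moreover have "1 + c * t / 2 \<le> (1 + h * c / 2) ^ n"
      using Bernoulli_inequality[of "h * c / 2" n] mult_pos_pos[OF h(1) c(1)] unfolding h(3)[symmetric] by (simp add: mult_ac)
    then have "(1 + c * t / 2) * measure lebesgue A \<le> (1 + h * c / 2) ^ n * measure lebesgue A"
      by (intro mult_right_mono) auto
    ultimately show ?thesis using meas[of n] by linarith
  qed
  have "(1 + c * t / 2) * measure lebesgue A \<le> measure lebesgue A + e" if "e > 0" for e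
  proof -
    obtain U where U: "open U" "A \<subseteq> U" "U - A \<in> lmeasurable" "emeasure lebesgue (U - A) < ennreal e"
      using sets_lebesgue_outer_open[OF fmeasurableD[OF lA] \<open>e > 0\<close>] by metis
    have Ueq: "U = A \<union> (U - A)" using U(2) by blast
    have lU: "U \<in> lmeasurable" by (subst Ueq) (intro fmeasurable.Un lA U(3))
    have "measure lebesgue U \<le> measure lebesgue A + measure lebesgue (U - A)"
      by (subst Ueq) (intro measure_Un_le fmeasurableD lA U(3))
    also have "measure lebesgue (U - A) \<le> e"
      using U(3,4) \<open>e > 0\<close> by (simp add: emeasure_eq_measure2 ennreal_less_iff)
    finally show ?thesis using key[OF U(1,2) lU] by simp
  qed
  then have "(1 + c * t / 2) * measure lebesgue A \<le> measure lebesgue A"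
    by (rule field_le_epsilon)
  then have "c * t / 2 * measure lebesgue A \<le> 0" by (simp add: algebra_simps)
  then show ?thesis using c(1) t measure_nonneg[of lebesgue A] by (auto simp: mult_le_0_iff)
qed auto

section \<open>Planar semiflows\<close>

lemma nonneg_derivative_imp_le:
  fixes f :: "real \<Rightarrow> real"
  assumes "a \<le> b"
    and d: "\<And>x. x \<in> {a..b} \<Longrightarrow> (f has_real_derivative f' x) (at x within {a..b})"
    and nonneg: "\<And>x. x \<in> {a..b} \<Longrightarrow> f' x \<ge> 0"
  shows "f a \<le> f b"
proof (cases "a = b")
  case False
  then have "a < b" using \<open>a \<le> b\<close> by simp
  from mvt_simple[OF this, of f "\<lambda>x. (*) (f' x)"] obtain x
    where x: "x \<in> {a<..<b}" "f b - f a = f' x * (b - a)"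
    using d by (auto simp: has_field_derivative_def)
  have "f' x * (b - a) \<ge> 0" using x(1) nonneg[of x] by (intro mult_nonneg_nonneg) auto
  then show ?thesis using x(2) by simp
qed simp

text \<open>
  A continuous semiflow \<open>\<phi>\<close> on a compact convex set \<open>K\<close> in the plane whose orbits solve
  \<open>x' = X x\<close>. The field \<open>X\<close> is continuously differentiable, with Jacobian matrix \<open>J\<close>, on an open
  set \<open>D\<close> around \<open>K\<close>. Only \<open>\<phi> t x\<close> with \<open>t \<ge> 0\<close> and \<open>x \<in> K\<close> is meaningful; at \<open>t = 0\<close> the
  derivative is one-sided.
\<close>

locale planar_semiflow =
  fixes D K :: "(real^2) set" and X :: "real^2 \<Rightarrow> real^2" and J :: "real^2 \<Rightarrow> real^2^2"
    and \<phi> :: "real \<Rightarrow> real^2 \<Rightarrow> real^2"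
  assumes D: "open D"
    and X_deriv: "\<And>x. x \<in> D \<Longrightarrow> (X has_derivative (*v) (J x)) (at x)"
    and cont_J: "continuous_on D J"
    and K: "compact K" "convex K" "K \<subseteq> D"
    and \<phi>_in: "\<And>t x. t \<ge> 0 \<Longrightarrow> x \<in> K \<Longrightarrow> \<phi> t x \<in> K"
    and \<phi>_0: "\<And>x. x \<in> K \<Longrightarrow> \<phi> 0 x = x"
    and \<phi>_add: "\<And>s t x. s \<ge> 0 \<Longrightarrow> t \<ge> 0 \<Longrightarrow> x \<in> K \<Longrightarrow> \<phi> (s + t) x = \<phi> s (\<phi> t x)"
    and \<phi>_cont: "continuous_on ({0..} \<times> K) (\<lambda>(t, x). \<phi> t x)"
    and \<phi>_deriv: "\<And>t x. t \<ge> 0 \<Longrightarrow> x \<in> K \<Longrightarrow> ((\<lambda>t. \<phi> t x) has_vector_derivative X (\<phi> t x)) (at t within {0..})"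
begin

lemma cont_X: "continuous_on K X"
  using X_deriv K(3) by (meson continuous_on_eq_continuous_within has_derivative_at_withinI has_derivative_continuous subsetD)

lemma cont_\<phi>:
  assumes "continuous_on S \<tau>" "continuous_on S \<xi>" "\<And>s. s \<in> S \<Longrightarrow> \<tau> s \<ge> 0 \<and> \<xi> s \<in> K"
  shows "continuous_on S (\<lambda>s. \<phi> (\<tau> s) (\<xi> s))"
proof -
  have "continuous_on S (\<lambda>s. case (\<tau> s, \<xi> s) of (t, x) \<Rightarrow> \<phi> t x)"
    by (rule continuous_on_compose2[OF \<phi>_cont continuous_on_Pair[OF assms(1,2)]]) (use assms(3) in auto)
  then show ?thesis by simp
qed

lemma cont_time: "x \<in> K \<Longrightarrow> S \<subseteq> {0..} \<Longrightarrow> continuous_on S (\<lambda>t. \<phi> t x)"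
  by (intro cont_\<phi> continuous_intros) auto

lemma cont_space: "t \<ge> 0 \<Longrightarrow> S \<subseteq> K \<Longrightarrow> continuous_on S (\<phi> t)"
  by (intro cont_\<phi>[of S "\<lambda>_. t" "\<lambda>x. x"] continuous_intros) auto

lemma Lipschitz_X:
  obtains L where "L > 0" "\<And>x y. x \<in> K \<Longrightarrow> y \<in> K \<Longrightarrow> norm (X x - X y) \<le> L * norm (x - y)"
proof -
  obtain L0 where L0: "\<And>x. x \<in> K \<Longrightarrow> norm (J x) \<le> L0"
    using compact_imp_bounded[OF compact_continuous_image[OF continuous_on_subset[OF cont_J K(3)] K(1)]]
    by (auto simp: bounded_iff)
  define L where "L = \<bar>4 * L0\<bar> + 1"
  have L: "L > 0" "onorm ((*v) (J x)) \<le> L" if "x \<in> K" for x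
    using onorm_matrix_le[of "J x"] L0[OF that] by (simp_all add: L_def)
  have "norm (X x - X y) \<le> L * norm (x - y)" if "x \<in> K" "y \<in> K" for x y
    by (rule differentiable_bound[OF K(2) has_derivative_at_withinI[OF X_deriv] L(2)]) (use that K(3) in auto)
  then show ?thesis using that[of L] by (simp add: L_def)
qed

text \<open>
  Backward uniqueness, by Gronwall's argument: if \<open>L\<close> is a Lipschitz constant of \<open>X\<close>, the squared
  distance of two orbits times \<open>exp (2 L s)\<close> does not decrease.
\<close>

lemma \<phi>_inj:
  assumes "t \<ge> 0" "x \<in> K" "y \<in> K" "\<phi> t x = \<phi> t y"
  shows "x = y"
proof -
  obtain L where L: "L > 0" "\<And>x y. x \<in> K \<Longrightarrow> y \<in> K \<Longrightarrow> norm (X x - X y) \<le> L * norm (x - y)"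
    using Lipschitz_X by blast
  define d where "d s = \<phi> s x - \<phi> s y" for s
  define d' where "d' s = X (\<phi> s x) - X (\<phi> s y)" for s
  let ?u = "\<lambda>s. exp (2 * L * s) * (d s \<bullet> d s)"
  let ?u' = "\<lambda>s. exp (2 * L * s) * (2 * L * (d s \<bullet> d s) + 2 * (d s \<bullet> d' s))"
  have "?u 0 \<le> ?u t"
  proof (rule nonneg_derivative_imp_le[OF assms(1)])
    fix s assume s: "s \<in> {0..t}"
    have "(d has_vector_derivative d' s) (at s within {0..t})"
      unfolding d_def[abs_def] d'_def
      by (intro derivative_intros has_vector_derivative_within_subset[OF \<phi>_deriv]) (use s assms in auto)
    then have "(d has_derivative (\<lambda>v. v *\<^sub>R d' s)) (at s within {0..t})" by (simp add: has_vector_derivative_def)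
    from has_derivative_inner[OF this this]
    have "((\<lambda>s. d s \<bullet> d s) has_real_derivative 2 * (d s \<bullet> d' s)) (at s within {0..t})"
      unfolding has_field_derivative_def
      by (rule has_derivative_eq_rhs) (auto simp: inner_commute algebra_simps)
    then show "(?u has_real_derivative ?u' s) (at s within {0..t})"
      by (auto intro!: derivative_eq_intros simp: algebra_simps)
    have "\<bar>d s \<bullet> d' s\<bar> \<le> norm (d s) * norm (d' s)" by (rule Cauchy_Schwarz_ineq2)
    also have "\<dots> \<le> norm (d s) * (L * norm (d s))"
      unfolding d_def d'_def by (intro mult_left_mono L(2) \<phi>_in) (use s assms in auto)
    also have "\<dots> = L * (d s \<bullet> d s)" by (simp add: power2_norm_eq_inner[symmetric] power2_eq_square)
    finally show "?u' s \<ge> 0" by simp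
  qed
  also have "?u t = 0" using assms(4) by (simp add: d_def)
  finally have "d 0 \<bullet> d 0 \<le> 0" by simp
  then have "d 0 = 0" by (meson inner_eq_zero_iff inner_ge_zero order_antisym)
  then show ?thesis using \<phi>_0 assms by (simp add: d_def)
qed

lemma \<phi>_inj_on: "t \<ge> 0 \<Longrightarrow> S \<subseteq> K \<Longrightarrow> inj_on (\<phi> t) S"
  by (intro inj_onI) (meson \<phi>_inj subsetD)

text \<open>Nonnegative times map the set into itself.\<close>

definition forward_invariant where
  "forward_invariant N \<longleftrightarrow> (\<forall>t\<ge>0. \<forall>x\<in>N. \<phi> t x \<in> N)"

text \<open>
  Zorn's lemma, applied to the complements of the compact, nonempty, forward invariant subsets.
\<close>

lemma minimal_set_exists:
  assumes M: "compact M" "M \<noteq> {}" "M \<subseteq> K" "forward_invariant M"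
  obtains N where "N \<subseteq> M" "compact N" "N \<noteq> {}" "forward_invariant N"
    "\<And>N'. N' \<subseteq> N \<Longrightarrow> compact N' \<Longrightarrow> N' \<noteq> {} \<Longrightarrow> forward_invariant N' \<Longrightarrow> N' = N"
proof -
  define \<A> where "\<A> = {A. - A \<subseteq> M \<and> compact (- A) \<and> - A \<noteq> {} \<and> forward_invariant (- A)}"
  have "\<exists>A\<in>\<A>. \<forall>B\<in>\<A>. A \<subseteq> B \<longrightarrow> B = A"
  proof (rule subset_Zorn_nonempty)
    have "- M \<in> \<A>" using M by (simp add: \<A>_def)
    then show "\<A> \<noteq> {}" by blast
    fix \<C> assume C: "\<C> \<noteq> {}" "subset.chain \<A> \<C>"
    have CA: "A \<in> \<A>" if "A \<in> \<C>" for A using C(2) that by (auto simp: subset.chain_def)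
    have eq: "- \<Union>\<C> = \<Inter>(uminus ` \<C>)" by auto
    have "\<Inter>(uminus ` \<C>) \<noteq> {}"
    proof (rule compact_chain)
      show "\<And>S. S \<in> uminus ` \<C> \<Longrightarrow> compact S" using CA by (auto simp: \<A>_def)
      show "{} \<notin> uminus ` \<C>" using CA by (force simp: \<A>_def)
      show "\<And>S T. S \<in> uminus ` \<C> \<and> T \<in> uminus ` \<C> \<Longrightarrow> S \<subseteq> T \<or> T \<subseteq> S"
        using C(2) by (fastforce simp: subset.chain_def)
    qed
    moreover have "compact (\<Inter>(uminus ` \<C>))"
      by (rule compact_Inter) (use C(1) CA in \<open>auto simp: \<A>_def\<close>)
    moreover have "\<Inter>(uminus ` \<C>) \<subseteq> M" using C(1) CA by (force simp: \<A>_def)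
    moreover have "forward_invariant (\<Inter>(uminus ` \<C>))"
      using CA by (auto simp: \<A>_def forward_invariant_def)
    ultimately show "\<Union>\<C> \<in> \<A>" unfolding \<A>_def mem_Collect_eq eq by blast
  qed
  then obtain A where A: "A \<in> \<A>" "\<And>B. B \<in> \<A> \<Longrightarrow> A \<subseteq> B \<Longrightarrow> B = A" by blast
  show ?thesis
  proof (rule that[of "- A"])
    fix N' assume N': "N' \<subseteq> - A" "compact N'" "N' \<noteq> {}" "forward_invariant N'"
    then have "- N' \<in> \<A>" using A(1) by (auto simp: \<A>_def)
    then show "N' = - A" using A(2)[of "- N'"] N'(1) by blast
  qed (use A(1) in \<open>auto simp: \<A>_def\<close>)
qed

text \<open>
  A minimal set of the semiflow: minimal with respect to inclusion among the compact, nonempty,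
  forward invariant subsets of \<open>K\<close>.
\<close>

definition minimal_set where
  "minimal_set N \<longleftrightarrow> N \<subseteq> K \<and> compact N \<and> N \<noteq> {} \<and> forward_invariant N \<and>
    (\<forall>N'. N' \<subseteq> N \<longrightarrow> compact N' \<longrightarrow> N' \<noteq> {} \<longrightarrow> forward_invariant N' \<longrightarrow> N' = N)"

lemma minimal_set_invariant:
  assumes "minimal_set N" "t \<ge> 0"
  shows "\<phi> t ` N = N"
proof -
  have N: "N \<subseteq> K" "compact N" "N \<noteq> {}" "forward_invariant N"
    using assms by (auto simp: minimal_set_def)
  have "forward_invariant (\<phi> t ` N)"
    unfolding forward_invariant_def
  proof clarify
    fix s x assume "0 \<le> (s::real)" "x \<in> N"
    then have "\<phi> s (\<phi> t x) = \<phi> t (\<phi> s x)" "\<phi> s x \<in> N"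
      using \<phi>_add[of s t x] \<phi>_add[of t s x] N(1,4) assms(2) by (auto simp: add.commute forward_invariant_def)
    then show "\<phi> s (\<phi> t x) \<in> \<phi> t ` N" by auto
  qed
  moreover have "compact (\<phi> t ` N)"
    by (intro compact_continuous_image cont_space N assms)
  moreover have "\<phi> t ` N \<subseteq> N" using N(4) assms(2) by (auto simp: forward_invariant_def)
  ultimately show ?thesis using assms(1) N(3) unfolding minimal_set_def by blast
qed

lemma minimal_set_recurrent:
  assumes "minimal_set N" "x \<in> N" "y \<in> N" "e > 0" "T \<ge> 0"
  shows "\<exists>t\<ge>T. dist (\<phi> t x) y < e"
proof -
  have N: "N \<subseteq> K" "compact N" "N \<noteq> {}" "forward_invariant N"
    using assms by (auto simp: minimal_set_def)
  let ?O = "(\<lambda>t. \<phi> t x) ` {T..}"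
  have ON: "?O \<subseteq> N" using N(4) assms(2,5) by (auto simp: forward_invariant_def)
  then have CN: "closure ?O \<subseteq> N" by (intro closure_minimal compact_imp_closed N)
  then have "compact (closure ?O)" using N(2) by (meson bounded_subset closed_closure compact_eq_bounded_closed)
  moreover have "forward_invariant (closure ?O)"
    unfolding forward_invariant_def
  proof (intro allI impI)
    fix s :: real assume s: "s \<ge> 0"
    have "\<phi> s ` closure ?O \<subseteq> closure ?O"
    proof (rule image_closure_subset)
      show "continuous_on (closure ?O) (\<phi> s)" by (intro cont_space s order_trans[OF CN N(1)])
      show "\<phi> s ` ?O \<subseteq> closure ?O"
      proof
        fix z assume "z \<in> \<phi> s ` ?O"
        then obtain t where "t \<ge> T" "z = \<phi> s (\<phi> t x)" by auto
        then have "z = \<phi> (s + t) x" "s + t \<ge> T"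
          using \<phi>_add[of s t x] s assms(2,5) N(1) by auto
        then show "z \<in> closure ?O" using closure_subset[of ?O] by auto
      qed
    qed simp
    then show "\<forall>z\<in>closure ?O. \<phi> s z \<in> closure ?O" by blast
  qed
  ultimately have "closure ?O = N" using assms(1) CN unfolding minimal_set_def by (simp add: closure_eq_empty)
  then have "y \<in> closure ?O" using assms(3) by simp
  then show ?thesis using assms(4) by (auto simp: closure_approachable)
qed

end

section \<open>Contraction of area and minimal sets\<close>

context planar_semiflow
begin

lemma expanding_imp_null:
  assumes div: "\<And>x. x \<in> D \<Longrightarrow> J x $ 1 $ 1 + J x $ 2 $ 2 > 0"
  shows "measure lebesgue K = 0"
proof (rule expanding_field_null_set[OF D X_deriv cont_J div K K(1), where t = 1])
  fix y assume y: "y \<in> K"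
  then show "\<exists>\<psi>. \<psi> 0 = y \<and> \<psi> 1 \<in> K \<and>
      (\<forall>s\<in>{0..1}. \<psi> s \<in> K \<and> (\<psi> has_vector_derivative X (\<psi> s)) (at s within {0..1}))"
    by (intro exI[of _ "\<lambda>t. \<phi> t y"])
      (auto simp: \<phi>_0 \<phi>_in intro!: has_vector_derivative_within_subset[OF \<phi>_deriv])
qed auto

text \<open>Here the time-reversed orbits are solution curves of \<open>- X\<close>, whose divergence is positive.\<close>

lemma contracting_imp_null:
  assumes div: "\<And>x. x \<in> D \<Longrightarrow> J x $ 1 $ 1 + J x $ 2 $ 2 < 0"
    and A: "compact A" "A \<subseteq> K" "A \<subseteq> \<phi> 1 ` A"
  shows "measure lebesgue A = 0"
proof (rule expanding_field_null_set[where X = "\<lambda>x. - X x" and J = "\<lambda>x. - J x" and D = D and K = K and t = 1])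
  fix x assume x: "x \<in> D"
  have "(*v) (- J x) = (\<lambda>v. - (J x *v v))" by (simp add: fun_eq_iff matrix_vector_mult_def sum_negf vec_eq_iff)
  then show "((\<lambda>x. - X x) has_derivative (*v) (- J x)) (at x)"
    using has_derivative_minus[OF X_deriv[OF x]] by simp
  show "(- J x) $ 1 $ 1 + (- J x) $ 2 $ 2 > 0" using div[OF x] by simp
next
  fix y assume y: "y \<in> A"
  then obtain z where z: "z \<in> A" "z \<in> K" "y = \<phi> 1 z" using A(2,3) by blast
  have "((\<lambda>t. \<phi> (1 - t) z) has_vector_derivative - X (\<phi> (1 - s) z)) (at s within {0..1})" if s: "s \<in> {0..1}" for s
  proof -
    have "((\<lambda>t. \<phi> t z) \<circ> (\<lambda>t. 1 - t) has_vector_derivative (- 1) *\<^sub>R X (\<phi> (1 - s) z)) (at s within {0..1})"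
    proof (rule vector_diff_chain_within)
      show "((\<lambda>t. 1 - t) has_vector_derivative - 1) (at s within {0..1})"
        by (auto intro!: derivative_eq_intros)
      show "((\<lambda>t. \<phi> t z) has_vector_derivative X (\<phi> (1 - s) z)) (at (1 - s) within (\<lambda>t. 1 - t) ` {0..1})"
        by (rule has_vector_derivative_within_subset[OF \<phi>_deriv]) (use s z in auto)
    qed
    then show ?thesis by (simp add: o_def)
  qed
  then show "\<exists>\<psi>. \<psi> 0 = y \<and> \<psi> 1 \<in> A \<and>
      (\<forall>s\<in>{0..1}. \<psi> s \<in> K \<and> (\<psi> has_vector_derivative - X (\<psi> s)) (at s within {0..1}))"
    using z by (intro exI[of _ "\<lambda>t. \<phi> (1 - t) z"]) (auto simp: \<phi>_0 \<phi>_in)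
qed (use D cont_J K A in \<open>auto intro: continuous_intros\<close>)

text \<open>
  A compact invariant set \<open>N\<close> does not separate the plane. A bounded component \<open>U\<close> of its complement
  would lie in the convex set \<open>K\<close> and would be mapped onto itself by \<open>\<phi> 1\<close>: the image is open by
  invariance of domain, it is relatively closed since the frontier of \<open>U\<close> is mapped into \<open>N\<close>, and
  it is contained in \<open>U\<close> because orbits do not enter \<open>N\<close> from outside. This contradicts the
  contraction of area.
\<close>

lemma invariant_set_connected_complement:
  assumes div: "\<And>x. x \<in> D \<Longrightarrow> J x $ 1 $ 1 + J x $ 2 $ 2 < 0"
    and N: "compact N" "N \<subseteq> K" "\<And>t. t \<ge> 0 \<Longrightarrow> \<phi> t ` N = N"
  shows "connected (- N)"
proof (rule ccontr)
  assume nc: "\<not> connected (- N)"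
  have clN: "closed N" and bN: "bounded N" using N(1) by (auto simp: compact_eq_bounded_closed)
  have "inside N \<noteq> {}"
  proof
    assume "inside N = {}"
    then have "outside N = - N" using union_with_inside[of N] by (metis Un_empty_right double_compl)
    then show False using nc connected_outside[OF bN] by simp
  qed
  then obtain y where y: "y \<in> inside N" by blast
  define U where "U = connected_component_set (- N) y"
  have yN: "y \<notin> N" using y by (simp add: inside_def)
  have U: "open U" "connected U" "y \<in> U" "U \<inter> N = {}"
    using clN yN connected_component_subset[of "- N" y]
    by (auto simp: U_def open_connected_component open_Compl)
  have "- K \<subseteq> outside N" by (rule outside_subset_convex[OF K(2) N(2)])
  then have "inside N \<subseteq> K" using inside_Int_outside[of N] by blast
  moreover have "U \<subseteq> inside N" using inside_same_component[OF _ y] by (auto simp: U_def)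
  ultimately have UK: "U \<subseteq> K" by blast
  have fr: "frontier U \<subseteq> N"
    unfolding U_def by (rule frontier_of_components_closed_complement[OF clN]) (use yN in \<open>auto simp: components_def\<close>)
  have clU: "closure U = U \<union> frontier U" by (simp add: closure_Un_frontier)
  have cUK: "closure U \<subseteq> K" by (rule closure_minimal[OF UK compact_imp_closed[OF K(1)]])
  have cU: "compact (closure U)" "closure U \<subseteq> K"
    using bounded_subset[OF compact_imp_bounded[OF K(1)] UK] cUK by (simp_all add: compact_closure)
  have dis: "\<phi> t x \<notin> N" if tx: "t \<ge> 0" "x \<in> U" for t x
  proof
    assume "\<phi> t x \<in> N"
    then obtain z where "z \<in> N" "\<phi> t z = \<phi> t x" using N(3)[OF tx(1)] by (metis imageE)
    then show False using \<phi>_inj[of t z x] tx UK N(2) U(4) by blast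
  qed
  have sub: "\<phi> 1 ` U \<subseteq> U"
  proof clarify
    fix x assume x: "x \<in> U"
    have "connected ((\<lambda>t. \<phi> t x) ` {0..1})"
      by (intro connected_continuous_image cont_time) (use x UK in auto)
    moreover have "(\<lambda>t. \<phi> t x) ` {0..1} \<subseteq> - N" using dis x by auto
    moreover have "\<phi> 0 x = x" using \<phi>_0 x UK by auto
    then have "x \<in> (\<lambda>t. \<phi> t x) ` {0..1}" by (intro image_eqI[of _ _ 0]) auto
    ultimately have "(\<lambda>t. \<phi> t x) ` {0..1} \<subseteq> connected_component_set (- N) x"
      by (intro connected_component_maximal)
    also have "connected_component_set (- N) x = U"
      using x unfolding U_def by (metis connected_component_eq mem_Collect_eq)
    finally show "\<phi> 1 x \<in> U" by auto
  qed
  have "open (\<phi> 1 ` U)"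
    by (intro invariance_of_domain cont_space \<phi>_inj_on U UK) auto
  then have "openin (top_of_set U) (\<phi> 1 ` U)" using sub by (rule open_subset[rotated])
  moreover have "closedin (top_of_set U) (\<phi> 1 ` U)"
  proof -
    have "\<phi> 1 ` U = U \<inter> \<phi> 1 ` closure U"
    proof -
      have "\<phi> 1 ` frontier U \<subseteq> N" using image_mono[OF fr, of "\<phi> 1"] N(3)[of 1] by simp
      then show ?thesis using sub U(4) unfolding clU by blast
    qed
    moreover have "closed (\<phi> 1 ` closure U)"
      by (intro compact_imp_closed compact_continuous_image cont_space cU) auto
    ultimately show ?thesis by (metis closedin_closed)
  qed
  ultimately have "\<phi> 1 ` U = U" using U(2,3) unfolding connected_clopen by blast
  then have "U \<subseteq> \<phi> 1 ` closure U" using closure_subset[of U] by blast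
  moreover have "closed (\<phi> 1 ` closure U)"
    by (intro compact_imp_closed compact_continuous_image cont_space cU) auto
  ultimately have "closure U \<subseteq> \<phi> 1 ` closure U" by (rule closure_minimal)
  then have "measure lebesgue (closure U) = 0" by (intro contracting_imp_null div cU)
  then have "negligible (closure U)" using cU(1) by (simp add: negligible_iff_measure lmeasurable_compact)
  then have "negligible U" using closure_subset negligible_subset by blast
  then show False using open_not_negligible[OF U(1)] U(3) by blast
qed

text \<open>
  Since the minimal set \<open>N\<close> does not separate the plane, the zero-free field \<open>X\<close> has a continuous
  logarithm on \<open>N\<close>, so \<open>no_recurrent_curve\<close> applies to the orbit through a lowest point \<open>q\<close> of \<open>N\<close>.
  The plane is identified with the complex numbers by \<open>c\<close>.
\<close>

lemma no_minimal_set_without_zeros: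
  assumes div: "\<And>x. x \<in> D \<Longrightarrow> J x $ 1 $ 1 + J x $ 2 $ 2 < 0"
    and min: "minimal_set N" and nz: "\<And>x. x \<in> N \<Longrightarrow> X x \<noteq> 0"
  shows False
proof -
  have N: "N \<subseteq> K" "compact N" "N \<noteq> {}" and fwd: "\<And>t x. t \<ge> 0 \<Longrightarrow> x \<in> N \<Longrightarrow> \<phi> t x \<in> N"
    using min by (auto simp: minimal_set_def forward_invariant_def)
  define c :: "real^2 \<Rightarrow> complex" where "c v = Complex (v $ 1) (v $ 2)" for v
  define c' :: "complex \<Rightarrow> real^2" where "c' z = vector [Re z, Im z]" for z
  have c'c: "c' (c v) = v" for v by (simp add: c_def c'_def vec_eq_iff forall_2)
  have cc': "c (c' z) = z" for z by (simp add: c_def c'_def)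
  have linc: "linear c" by (rule linearI) (auto simp: c_def complex_eq_iff)
  then have blc: "bounded_linear c" by (simp add: linear_linear)
  have "linear c'" by (rule linearI) (auto simp: c'_def vec_eq_iff forall_2)
  then have blc': "bounded_linear c'" by (simp add: linear_linear)
  have cc0: "c v = 0 \<longleftrightarrow> v = 0" for v using c'c linear_0[OF linc] by metis
  have "bij c" by (rule o_bij[of c']) (auto simp: fun_eq_iff c'c cc')
  then have "- c ` N = c ` (- N)" by (simp add: bij_image_Compl_eq)
  then have "connected (- c ` N)"
    using invariant_set_connected_complement[OF div N(2,1) minimal_set_invariant[OF min]]
    by (auto intro!: connected_continuous_image linear_continuous_on blc)
  moreover have "compact (c ` N)" by (intro compact_continuous_image linear_continuous_on blc N)
  ultimately have "Borsukian (c ` N)" by (simp add: Borsukian_separation_compact)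
  moreover have "continuous_on (c ` N) (\<lambda>z. c (X (c' z)))"
    by (intro continuous_on_compose2[OF linear_continuous_on[OF blc, of UNIV]]
        continuous_on_compose2[OF cont_X] linear_continuous_on blc') (use N(1) c'c in auto)
  moreover have "(\<lambda>z. c (X (c' z))) \<in> c ` N \<rightarrow> - {0}" using nz by (auto simp: c'c cc0)
  ultimately obtain g where g: "continuous_on (c ` N) g" "\<And>z. z \<in> c ` N \<Longrightarrow> c (X (c' z)) = exp (g z)"
    unfolding Borsukian_continuous_logarithm by blast
  have gX: "exp (g (c v)) = c (X v)" if "v \<in> N" for v using g(2)[of "c v"] that by (simp add: c'c)
  have "continuous_on N (\<lambda>z. z $ 2)" by (intro continuous_intros)
  then obtain q where q: "q \<in> N" "\<And>z. z \<in> N \<Longrightarrow> q $ 2 \<le> z $ 2"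
    using continuous_attains_inf[OF N(2,3)] by blast
  have "q \<in> \<phi> 1 ` N" using minimal_set_invariant[OF min, of 1] q(1) by simp
  then obtain q0 where q0: "q0 \<in> N" "q0 \<in> K" "\<phi> 1 q0 = q"
    using N(1) by blast
  have x_deriv: "((\<lambda>t. c (\<phi> t q0)) has_vector_derivative exp (g (c (\<phi> t q0)))) (at t within {0..})" if "t \<ge> 0" for t
    using bounded_linear.has_vector_derivative[OF blc \<phi>_deriv[OF that q0(2)]] gX fwd[OF that q0(1)] by simp
  have backward: "\<phi> (s - r) q0 = \<phi> (t - r) q0" if "0 \<le> r" "r \<le> s" "s \<le> t" "\<phi> s q0 = \<phi> t q0" for r s t
  proof (rule \<phi>_inj[of r])
    show "\<phi> r (\<phi> (s - r) q0) = \<phi> r (\<phi> (t - r) q0)"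
      using that q0 \<phi>_add[of r "s - r" q0] \<phi>_add[of r "t - r" q0] by simp
  qed (use that q0 \<phi>_in in auto)
  have recurrent: "\<exists>\<tau>\<ge>2. \<forall>s\<in>{0..2}. dist (\<phi> (s + \<tau>) q0) (\<phi> s q0) < \<delta>" if "\<delta> > 0" for \<delta>
  proof -
    have "uniformly_continuous_on ({0..2} \<times> K) (\<lambda>(t, x). \<phi> t x)"
      by (intro compact_uniformly_continuous continuous_on_subset[OF \<phi>_cont] compact_Times K) auto
    then obtain e where e: "e > 0" "\<And>p p'. p \<in> {0..2} \<times> K \<Longrightarrow> p' \<in> {0..2} \<times> K \<Longrightarrow> dist p' p < e \<Longrightarrow>
        dist (case p' of (t, x) \<Rightarrow> \<phi> t x) (case p of (t, x) \<Rightarrow> \<phi> t x) < \<delta>"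
      using \<open>\<delta> > 0\<close> unfolding uniformly_continuous_on_def by metis
    obtain \<tau> where \<tau>: "\<tau> \<ge> 2" "dist (\<phi> \<tau> q0) q0 < e"
      using minimal_set_recurrent[OF min q0(1) q0(1) e(1), of 2] by auto
    have "dist (\<phi> (s + \<tau>) q0) (\<phi> s q0) < \<delta>" if "s \<in> {0..2}" for s
      using e(2)[of "(s, q0)" "(s, \<phi> \<tau> q0)"] \<phi>_add[of s \<tau> q0] that \<tau> q0 \<phi>_in[of \<tau> q0]
      by (auto simp: dist_Pair_Pair)
    then show ?thesis using \<tau>(1) by blast
  qed
  have distc: "dist (c v) (c w) = dist v w" for v w
    by (simp add: dist_norm c_def cmod_def norm_vec_def L2_set_def sum_2 complex_eq_iff)
  show False
  proof (cases "Re (exp (g (c q))) \<ge> 0")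
    case True
    show False
    proof (rule no_recurrent_curve[where x = "\<lambda>t. c (\<phi> t q0)" and g = g and N = "c ` N"])
      show "c (\<phi> t q0) \<in> c ` N" if "t \<ge> 0" for t using fwd[OF that q0(1)] by blast
      show "Im (c (\<phi> 1 q0)) \<le> Im (c (\<phi> t q0))" if "t \<ge> 0" for t
        using q(2)[OF fwd[OF that q0(1)]] q0(3) by (simp add: c_def)
      show "c (\<phi> (s - r) q0) = c (\<phi> (t - r) q0)"
        if "0 \<le> r" "r \<le> s" "s \<le> t" "c (\<phi> s q0) = c (\<phi> t q0)" for s t r
        using backward[OF that(1-3)] that(4) c'c by metis
      show "\<exists>\<tau>\<ge>2. \<forall>s\<in>{0..2}. dist (c (\<phi> (s + \<tau>) q0)) (c (\<phi> s q0)) < \<delta>" if "\<delta> > 0" for \<delta>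
        using recurrent[OF that] by (simp add: distc)
    qed (use x_deriv g(1) q0(3) True in simp_all)
  next
    case False
    \<comment> \<open>If the orbit passes \<open>q\<close> from right to left, reflect in the imaginary axis.\<close>
    define m where "m z = - cnj z" for z
    have mm: "m (m z) = z" for z by (simp add: m_def)
    have blm: "bounded_linear m" unfolding m_def[abs_def]
      by (intro bounded_linear_minus bounded_linear_cnj)
    define g2 where "g2 z = cnj (g (m z)) + \<i> * pi" for z
    have exp_g2: "exp (g2 (m z)) = m (exp (g z))" for z
      by (simp add: g2_def mm exp_add exp_cnj[symmetric]) (simp add: m_def)
    have distm: "dist (m z) (m w) = dist z w" for z w
      by (simp add: m_def dist_norm) (metis complex_cnj_diff complex_mod_cnj norm_minus_commute)
    show False
    proof (rule no_recurrent_curve[where x = "\<lambda>t. m (c (\<phi> t q0))" and g = g2 and N = "m ` c ` N"])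
      fix t :: real assume t: "t \<ge> 0"
      show "((\<lambda>t. m (c (\<phi> t q0))) has_vector_derivative exp (g2 (m (c (\<phi> t q0))))) (at t within {0..})"
        unfolding exp_g2 by (rule bounded_linear.has_vector_derivative[OF blm x_deriv[OF t]])
      show "m (c (\<phi> t q0)) \<in> m ` c ` N" using fwd[OF t q0(1)] by blast
      show "Im (m (c (\<phi> 1 q0))) \<le> Im (m (c (\<phi> t q0)))"
        using q(2)[OF fwd[OF t q0(1)]] q0(3) by (simp add: m_def c_def)
    next
      show "continuous_on (m ` c ` N) g2"
        unfolding g2_def
        by (intro continuous_intros continuous_on_compose2[OF g(1)] linear_continuous_on blm) (auto simp: mm)
      show "0 \<le> Re (exp (g2 (m (c (\<phi> 1 q0)))))" unfolding exp_g2 using False q0(3) by (simp add: m_def)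
      show "m (c (\<phi> (s - r) q0)) = m (c (\<phi> (t - r) q0))"
        if "0 \<le> r" "r \<le> s" "s \<le> t" "m (c (\<phi> s q0)) = m (c (\<phi> t q0))" for s t r
        using backward[OF that(1-3)] that(4) mm c'c by metis
      show "\<exists>\<tau>\<ge>2. \<forall>s\<in>{0..2}. dist (m (c (\<phi> (s + \<tau>) q0))) (m (c (\<phi> s q0))) < \<delta>" if "\<delta> > 0" for \<delta>
        using recurrent[OF that] by (simp add: distm distc)
    qed
  qed
qed

text \<open>
  The points of \<open>K\<close> that are not attracted by \<open>p\<close> form a compact forward invariant set \<open>M\<close>. If it
  were nonempty, it would contain a minimal set, and this would contain a zero of \<open>X\<close> other than
  \<open>p\<close>.
\<close>

theorem contracting_flow_converges:
  assumes div: "\<And>x. x \<in> D \<Longrightarrow> J x $ 1 $ 1 + J x $ 2 $ 2 < 0"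
    and zeros: "\<And>x. x \<in> K \<Longrightarrow> X x = 0 \<Longrightarrow> x = p"
    and r: "r > 0" "\<And>x. x \<in> K \<Longrightarrow> dist x p < r \<Longrightarrow> ((\<lambda>t. \<phi> t x) \<longlongrightarrow> p) at_top"
    and x: "x \<in> K"
  shows "((\<lambda>t. \<phi> t x) \<longlongrightarrow> p) at_top"
proof (rule ccontr)
  assume nconv: "\<not> ((\<lambda>t. \<phi> t x) \<longlongrightarrow> p) at_top"
  define M where "M = {z \<in> K. \<not> ((\<lambda>t. \<phi> t z) \<longlongrightarrow> p) at_top}"
  have shift: "((\<lambda>t. \<phi> t (\<phi> s z)) \<longlongrightarrow> p) at_top \<longleftrightarrow> ((\<lambda>t. \<phi> t z) \<longlongrightarrow> p) at_top" if "s \<ge> 0" "z \<in> K" for s z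
  proof -
    have "((\<lambda>t. \<phi> t (\<phi> s z)) \<longlongrightarrow> p) at_top \<longleftrightarrow> ((\<lambda>t. \<phi> (t + s) z) \<longlongrightarrow> p) at_top"
      by (intro tendsto_cong eventually_mono[OF eventually_ge_at_top[of 0]]) (use \<phi>_add that in auto)
    also have "\<dots> \<longleftrightarrow> ((\<lambda>t. \<phi> t z) \<longlongrightarrow> p) at_top"
    proof -
      have add: "filterlim (\<lambda>t. t + c) at_top at_top" for c :: real
        using filterlim_tendsto_add_at_top[OF tendsto_const[of c] filterlim_ident] by (simp add: add.commute)
      show ?thesis
        using filterlim_compose[OF _ add[of s], of "\<lambda>t. \<phi> t z" "nhds p"]
          filterlim_compose[OF _ add[of "- s"], of "\<lambda>t. \<phi> (t + s) z" "nhds p"] by auto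
    qed
    finally show ?thesis .
  qed
  have fwdM: "\<phi> s z \<in> M" if "s \<ge> 0" "z \<in> M" for s z
    using that shift[of s z] \<phi>_in[of s z] by (auto simp: M_def)
  have "closed M"
    unfolding closed_sequential_limits
  proof (intro allI impI, elim conjE)
    fix u l assume u: "\<forall>n. u n \<in> M" "u \<longlonglongrightarrow> l"
    have lK: "l \<in> K"
      by (rule closed_sequentially[OF compact_imp_closed[OF K(1)] _ u(2)]) (use u(1) in \<open>auto simp: M_def\<close>)
    show "l \<in> M"
    proof (rule ccontr)
      assume "l \<notin> M"
      then have "((\<lambda>t. \<phi> t l) \<longlongrightarrow> p) at_top" using lK by (simp add: M_def)
      then have "\<forall>\<^sub>F t in at_top. dist (\<phi> t l) p < r" using r(1) by (rule tendstoD)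
      then obtain T where T: "T \<ge> 0" "dist (\<phi> T l) p < r"
        by (metis eventually_at_top_linorder linear)
      have "(\<lambda>n. \<phi> T (u n)) \<longlonglongrightarrow> \<phi> T l"
        by (rule continuous_on_tendsto_compose[OF cont_space[OF T(1) order_refl] u(2) lK]) (use u in \<open>auto simp: M_def\<close>)
      then have "(\<lambda>n. dist (\<phi> T (u n)) p) \<longlonglongrightarrow> dist (\<phi> T l) p" by (intro tendsto_intros)
      then have "\<forall>\<^sub>F n in sequentially. dist (\<phi> T (u n)) p < r" using T(2) by (rule order_tendstoD)
      then obtain n where "dist (\<phi> T (u n)) p < r" by (auto simp: eventually_sequentially)
      moreover have "\<phi> T (u n) \<in> M" using fwdM[OF T(1)] u by blast
      ultimately show False using r(2)[of "\<phi> T (u n)"] by (auto simp: M_def)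
    qed
  qed
  moreover have MK: "M \<subseteq> K" by (auto simp: M_def)
  ultimately have "compact M"
    using bounded_subset[OF compact_imp_bounded[OF K(1)]] by (simp add: compact_eq_bounded_closed)
  moreover have "M \<noteq> {}" using nconv x by (auto simp: M_def)
  moreover have "forward_invariant M" using fwdM by (simp add: forward_invariant_def)
  ultimately obtain N where N: "N \<subseteq> M" "minimal_set N"
    by (rule minimal_set_exists[OF _ _ MK]) (use MK in \<open>auto simp: minimal_set_def\<close>)
  have "X z \<noteq> 0" if "z \<in> N" for z
  proof
    assume "X z = 0"
    then have "z = p" using zeros N(1) that MK by blast
    then show False using r N(1) that by (auto simp: M_def)
  qed
  then show False using no_minimal_set_without_zeros[OF div N(2)] by blast
qed

end

section \<open>Attraction by a linearly stable equilibrium\<close>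

text \<open>
  For the linearisation \<open>A\<close> with negative trace and positive determinant, a quadratic Lyapunov
  function is \<open>V v = (det A) |v|\<^sup>2 + |B v|\<^sup>2\<close>, where \<open>B\<close> is the adjugate of \<open>A\<close>: as \<open>B A = (det A) I\<close>
  and \<open>A + B = (tr A) I\<close>, its derivative along \<open>v' = A v\<close> is \<open>2 (tr A) (det A) |v|\<^sup>2\<close>. The
  equilibrium may lie on the boundary of \<open>K\<close>; attraction is claimed for points of \<open>K\<close> only.
\<close>

lemma (in planar_semiflow) linearly_stable_imp_attracting:
  assumes p: "p \<in> K" "X p = 0"
    and tr: "J p $ 1 $ 1 + J p $ 2 $ 2 < 0" and det: "det (J p) > 0"
  obtains r where "r > 0" "\<And>x. x \<in> K \<Longrightarrow> dist x p < r \<Longrightarrow> ((\<lambda>t. \<phi> t x) \<longlongrightarrow> p) at_top"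
proof -
  define A where "A = J p"
  define a where "a = det A"
  define \<tau> where "\<tau> = - (A $ 1 $ 1 + A $ 2 $ 2)"
  define B :: "real^2 \<Rightarrow> real^2"
    where "B v = vector [A $ 2 $ 2 * v $ 1 - A $ 1 $ 2 * v $ 2, A $ 1 $ 1 * v $ 2 - A $ 2 $ 1 * v $ 1]" for v
  have a: "a > 0" and \<tau>: "\<tau> > 0" using tr det by (simp_all add: a_def \<tau>_def A_def)
  have "linear B" by (rule linearI) (auto simp: B_def vec_eq_iff forall_2 algebra_simps)
  then have blB: "bounded_linear B" by (simp add: linear_linear)
  obtain b where b: "b > 0" "\<And>v. norm (B v) \<le> norm v * b"
    using bounded_linear.pos_bounded[OF blB] by blast
  define C where "C = a + b\<^sup>2"
  have C: "C > 0" using a by (simp add: C_def add_pos_nonneg)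
  define V where "V v = a * (v \<bullet> v) + B v \<bullet> B v" for v
  have lyap: "a * (v \<bullet> (A *v v)) + B v \<bullet> B (A *v v) = - \<tau> * a * (v \<bullet> v)" for v
    by (simp add: a_def \<tau>_def B_def det_2 inner_vec_def sum_2 matrix_vector_mult_def algebra_simps)
  have V_le: "V v \<le> C * (v \<bullet> v)" for v
  proof -
    have "B v \<bullet> B v = (norm (B v))\<^sup>2" by (simp add: power2_norm_eq_inner)
    also have "\<dots> \<le> (norm v * b)\<^sup>2" using b(2) by (intro power_mono) auto
    also have "\<dots> = b\<^sup>2 * (v \<bullet> v)" by (simp add: power_mult_distrib power2_norm_eq_inner)
    finally show ?thesis by (simp add: V_def C_def algebra_simps)
  qed
  have V_ge: "a * (norm v)\<^sup>2 \<le> V v" for v by (simp add: V_def power2_norm_eq_inner)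
  \<comment> \<open>A nonlinear remainder of norm at most \<open>\<epsilon> |v|\<close> uses up at most half of the decay of \<open>V\<close>.\<close>
  define \<epsilon> where "\<epsilon> = \<tau> * a / (2 * C)"
  have eps: "\<epsilon> > 0" using a \<tau> C by (simp add: \<epsilon>_def)
  have "(X has_derivative (*v) A) (at p)" using X_deriv p(1) K(3) by (auto simp: A_def)
  then obtain \<rho> where \<rho>: "\<rho> > 0" "\<And>y. norm (y - p) < \<rho> \<Longrightarrow> norm (X y - X p - A *v (y - p)) \<le> \<epsilon> * norm (y - p)"
    using eps unfolding has_derivative_at_alt by metis
  have dV: "2 * (a * (v \<bullet> X (p + v)) + B v \<bullet> B (X (p + v))) \<le> - (\<tau> * a) * (v \<bullet> v)" if "norm v < \<rho>" for v
  proof -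
    define e where "e = X (p + v) - A *v v"
    have e: "norm e \<le> \<epsilon> * norm v" using \<rho>(2)[of "p + v"] that p(2) by (simp add: e_def)
    have X: "X (p + v) = A *v v + e" by (simp add: e_def)
    have "a * (v \<bullet> e) \<le> a * (norm v * (\<epsilon> * norm v))"
      using e a by (intro mult_left_mono order_trans[OF norm_cauchy_schwarz] mult_left_mono) auto
    moreover have "B v \<bullet> B e \<le> (norm v * b) * ((\<epsilon> * norm v) * b)"
      using b e by (intro order_trans[OF norm_cauchy_schwarz] mult_mono order_trans[OF b(2)[of e]] mult_right_mono) auto
    ultimately have "a * (v \<bullet> e) + B v \<bullet> B e \<le> C * \<epsilon> * (v \<bullet> v)"
      by (simp add: C_def power2_norm_eq_inner[symmetric] power2_eq_square algebra_simps)
    also have "C * \<epsilon> = \<tau> * a / 2" using C by (simp add: \<epsilon>_def)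
    finally have "2 * (a * (v \<bullet> e) + B v \<bullet> B e) \<le> \<tau> * a * (v \<bullet> v)" by simp
    moreover have "a * (v \<bullet> X (p + v)) + B v \<bullet> B (X (p + v)) = - \<tau> * a * (v \<bullet> v) + (a * (v \<bullet> e) + B v \<bullet> B e)"
      unfolding X linear_add[OF \<open>linear B\<close>] using lyap[of v] by (simp add: inner_add_right algebra_simps)
    ultimately show ?thesis by (simp add: algebra_simps)
  qed
  define \<kappa> where "\<kappa> = \<tau> * a / C"
  have kappa: "\<kappa> > 0" using \<tau> a C by (simp add: \<kappa>_def)
  define \<rho>' where "\<rho>' = \<rho> / 2"
  have \<rho>': "\<rho>' > 0" "\<rho>' < \<rho>" using \<rho>(1) by (simp_all add: \<rho>'_def)
  define r where "r = \<rho>' * sqrt (a / C)"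
  have r: "r > 0" using \<rho>' a C by (simp add: r_def)
  have decay: "exp (\<kappa> * t) * V (\<phi> t x - p) \<le> V (x - p)"
    if x: "x \<in> K" and t: "t \<ge> 0" and small: "\<And>s. s \<in> {0..t} \<Longrightarrow> norm (\<phi> s x - p) < \<rho>" for x t
  proof -
    let ?d = "\<lambda>s. \<phi> s x - p" and ?d' = "\<lambda>s. X (\<phi> s x)"
    let ?V' = "\<lambda>s. 2 * (a * (?d s \<bullet> ?d' s) + B (?d s) \<bullet> B (?d' s))"
    have "- (exp (\<kappa> * 0) * V (?d 0)) \<le> - (exp (\<kappa> * t) * V (?d t))"
    proof (rule nonneg_derivative_imp_le[OF t, where f = "\<lambda>s. - (exp (\<kappa> * s) * V (?d s))"])
      fix s assume s: "s \<in> {0..t}"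
      have d: "(?d has_vector_derivative ?d' s) (at s within {0..t})"
        using has_vector_derivative_diff_const[of "\<lambda>s. \<phi> s x" p "?d' s"] s x
        by (auto intro!: has_vector_derivative_within_subset[OF \<phi>_deriv])
      then have 1: "(?d has_derivative (\<lambda>h. h *\<^sub>R ?d' s)) (at s within {0..t})"
        by (simp add: has_vector_derivative_def)
      have 2: "((\<lambda>s. B (?d s)) has_derivative (\<lambda>h. h *\<^sub>R B (?d' s))) (at s within {0..t})"
        using bounded_linear.has_vector_derivative[OF blB d] by (simp add: has_vector_derivative_def)
      have "((\<lambda>s. V (?d s)) has_real_derivative ?V' s) (at s within {0..t})"
        unfolding V_def has_field_derivative_def
        by (rule has_derivative_eq_rhs[OF has_derivative_add[OF has_derivative_mult_right[OF has_derivative_inner[OF 1 1]] has_derivative_inner[OF 2 2]]])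
          (auto simp: inner_commute algebra_simps)
      then show "((\<lambda>s. - (exp (\<kappa> * s) * V (?d s))) has_real_derivative - (exp (\<kappa> * s) * (\<kappa> * V (?d s) + ?V' s))) (at s within {0..t})"
        by (auto intro!: derivative_eq_intros simp: algebra_simps)
      have "\<kappa> * V (?d s) \<le> \<kappa> * (C * (?d s \<bullet> ?d s))" using V_le kappa by (intro mult_left_mono) auto
      also have "\<dots> = \<tau> * a * (?d s \<bullet> ?d s)" using C by (simp add: \<kappa>_def)
      finally have "\<kappa> * V (?d s) + ?V' s \<le> 0" using dV[OF small[OF s]] by simp
      then show "0 \<le> - (exp (\<kappa> * s) * (\<kappa> * V (?d s) + ?V' s))" by (simp add: mult_nonneg_nonpos)
    qed
    then show ?thesis using \<phi>_0[OF x] by simp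
  qed
  have start: "V (x - p) < a * \<rho>'\<^sup>2" if "dist x p < r" for x
  proof -
    have "(norm (x - p))\<^sup>2 < r\<^sup>2" using that by (intro power_strict_mono) (auto simp: dist_norm)
    then have "C * ((x - p) \<bullet> (x - p)) < C * r\<^sup>2" using C by (simp add: power2_norm_eq_inner)
    also have "\<dots> = a * \<rho>'\<^sup>2" using a C by (simp add: r_def power_mult_distrib)
    finally show ?thesis using V_le[of "x - p"] by simp
  qed
  have stay: "norm (\<phi> t x - p) < \<rho>'" if x: "x \<in> K" "dist x p < r" and t: "t \<ge> 0" for x t
  proof (rule ccontr)
    assume "\<not> norm (\<phi> t x - p) < \<rho>'"
    \<comment> \<open>\<open>T\<close> is the first time at which the orbit leaves the open disc of radius \<open>\<rho>'\<close>.\<close>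
    define S where "S = {s \<in> {0..t}. \<rho>' \<le> norm (\<phi> s x - p)}"
    have cn: "continuous_on {0..t} (\<lambda>s. norm (\<phi> s x - p))"
      by (intro continuous_intros cont_time x) auto
    have "S = {0..t} \<inter> (\<lambda>s. norm (\<phi> s x - p)) -` {\<rho>'..}" by (auto simp: S_def)
    then have "closed S" using continuous_closed_preimage[OF cn closed_atLeastAtMost closed_atLeast] by simp
    moreover have "bounded S" by (rule bounded_subset[of "{0..t}"]) (auto simp: S_def)
    ultimately have "compact S" by (simp add: compact_eq_bounded_closed)
    moreover have "t \<in> S" using \<open>\<not> norm (\<phi> t x - p) < \<rho>'\<close> t by (simp add: S_def)
    ultimately obtain T where T: "T \<in> S" "\<And>s. s \<in> S \<Longrightarrow> T \<le> s"
      using continuous_attains_inf[of S "\<lambda>s. s"] by auto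
    have T0: "0 \<le> T" "T \<le> t" using T(1) by (auto simp: S_def)
    have before: "norm (\<phi> s x - p) < \<rho>'" if "0 \<le> s" "s < T" for s
      using T(2)[of s] that T0 by (force simp: S_def)
    have "0 < T" 
    proof (rule ccontr)
      assume "\<not> 0 < T"
      then have "T = 0" using T0 by simp
      then have "\<rho>' \<le> norm (x - p)" using T(1) \<phi>_0 x by (simp add: S_def)
      then have "a * \<rho>'\<^sup>2 \<le> a * (norm (x - p))\<^sup>2" using a \<rho>' by (intro mult_left_mono power_mono) auto
      then show False using V_ge[of "x - p"] start[OF x(2)] by simp
    qed
    have le: "norm (\<phi> T x - p) \<le> \<rho>'"
    proof (rule continuous_le_on_closure[where S = "{0..<T}" and f = "\<lambda>s. norm (\<phi> s x - p)"])
      show "continuous_on (closure {0..<T}) (\<lambda>s. norm (\<phi> s x - p))"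
        by (rule continuous_on_subset[OF cn]) (use T0 \<open>0 < T\<close> in auto)
    qed (use before \<open>0 < T\<close> in \<open>auto intro: less_imp_le\<close>)
    have "exp (\<kappa> * T) * V (\<phi> T x - p) \<le> V (x - p)"
    proof (rule decay[OF x(1) T0(1)])
      fix s assume "s \<in> {0..T}"
      then show "norm (\<phi> s x - p) < \<rho>" using before[of s] le \<rho>' by (cases "s = T") auto
    qed
    moreover have "V (\<phi> T x - p) \<le> exp (\<kappa> * T) * V (\<phi> T x - p)"
      using mult_right_mono[of 1 "exp (\<kappa> * T)" "V (\<phi> T x - p)"] kappa T0 a by (simp add: V_def)
    moreover have "a * \<rho>'\<^sup>2 \<le> a * (norm (\<phi> T x - p))\<^sup>2"
      using T(1) a \<rho>' by (intro mult_left_mono power_mono) (auto simp: S_def)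
    ultimately show False using V_ge[of "\<phi> T x - p"] start[OF x(2)] by linarith
  qed
  have "((\<lambda>t. \<phi> t x) \<longlongrightarrow> p) at_top" if x: "x \<in> K" "dist x p < r" for x
  proof -
    have bound: "(norm (\<phi> t x - p))\<^sup>2 \<le> (V (x - p) / a) * exp (- \<kappa> * t)" if t: "t \<ge> 0" for t
    proof -
      have "exp (\<kappa> * t) * V (\<phi> t x - p) \<le> V (x - p)"
        using stay[OF x] \<rho>' by (intro decay x(1) t) (auto intro: less_trans)
      then have "V (\<phi> t x - p) \<le> V (x - p) * exp (- \<kappa> * t)" by (simp add: exp_minus field_simps)
      then show ?thesis using V_ge[of "\<phi> t x - p"] a by (simp add: field_simps)
    qed
    have "((\<lambda>t. exp (- \<kappa> * t)) \<longlongrightarrow> 0) at_top"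
      using kappa by real_asymp
    then have upper: "((\<lambda>t. (V (x - p) / a) * exp (- \<kappa> * t)) \<longlongrightarrow> 0) at_top" by (rule tendsto_mult_right_zero)
    have below: "\<forall>\<^sub>F t in at_top. (norm (\<phi> t x - p))\<^sup>2 \<le> (V (x - p) / a) * exp (- \<kappa> * t)"
      using eventually_ge_at_top[of "0::real"] by eventually_elim (rule bound)
    have "((\<lambda>t. (norm (\<phi> t x - p))\<^sup>2) \<longlongrightarrow> 0) at_top"
      by (rule tendsto_sandwich[OF _ below tendsto_const upper]) simp
    then have "((\<lambda>t. norm (\<phi> t x - p)) \<longlongrightarrow> 0) at_top"
      by (auto dest: tendsto_real_sqrt)
    then show ?thesis by (simp add: LIM_zero_iff tendsto_norm_zero_iff)
  qed
  then show ?thesis using that[OF r] by blast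
qed

section \<open>Differential equations from right derivatives\<close>

lemma constant_if_right_derivative_zero:
  fixes u :: "real \<Rightarrow> 'a::real_normed_vector"
  assumes cont: "continuous_on {0..} u"
    and der: "\<And>t. t \<ge> 0 \<Longrightarrow> (u has_vector_derivative 0) (at t within {t..})"
    and t: "t \<ge> 0"
  shows "u t = u 0"
proof -
  have bound: "norm (u t - u 0) \<le> e * t" if e: "e > 0" for e
  proof (rule ccontr)
    assume big: "\<not> norm (u t - u 0) \<le> e * t"
    define S where "S = {s \<in> {0..t}. norm (u s - u 0) - e * s \<le> 0}"
    have "continuous_on {0..t} (\<lambda>s. norm (u s - u 0) - e * s)"
      by (intro continuous_intros continuous_on_subset[OF cont]) auto
    moreover have "S = {0..t} \<inter> (\<lambda>s. norm (u s - u 0) - e * s) -` {..0}" by (auto simp: S_def)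
    ultimately have "closed S" by (simp add: continuous_closed_preimage)
    moreover have "bounded S" by (rule bounded_subset[of "{0..t}"]) (auto simp: S_def)
    ultimately have "compact S" by (simp add: compact_eq_bounded_closed)
    moreover have "0 \<in> S" using t by (simp add: S_def)
    \<comment> \<open>\<open>m\<close> is the last time at which the linear bound holds; it persists a little longer.\<close>
    ultimately obtain m where m: "m \<in> S" "\<And>s. s \<in> S \<Longrightarrow> s \<le> m"
      using continuous_attains_sup[of S "\<lambda>s. s"] by auto
    have m0: "0 \<le> m" "m < t" "norm (u m - u 0) \<le> e * m"
      using m(1) big by (auto simp: S_def order.order_iff_strict)
    have "(u has_derivative (\<lambda>h. 0)) (at m within {m..})"
      using der[OF m0(1)] by (simp add: has_vector_derivative_def)
    then obtain d where d: "d > 0" "\<And>s. s \<in> {m..} \<Longrightarrow> norm (s - m) < d \<Longrightarrow> norm (u s - u m - 0) \<le> e * norm (s - m)"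
      using e unfolding has_derivative_within_alt by metis
    define s where "s = m + min (d/2) (t - m)"
    have s: "m < s" "s \<le> t" "s - m < d" using d(1) m0 by (auto simp: s_def min_def)
    have "norm (u s - u 0) \<le> norm (u s - u m) + norm (u m - u 0)" 
      using norm_triangle_ineq[of "u s - u m" "u m - u 0"] by simp
    also have "\<dots> \<le> e * (s - m) + e * m" using d(2)[of s] s m0 by (intro add_mono) auto
    finally have "s \<in> S" using s m0 by (simp add: S_def algebra_simps)
    then show False using m(2) s(1) by fastforce
  qed
  have "norm (u t - u 0) \<le> 0 + e" if "e > 0" for e
  proof (cases "t = 0")
    case False
    then show ?thesis using bound[of "e / t"] that t by simp
  qed (use that in simp)
  then have "norm (u t - u 0) \<le> 0" by (rule field_le_epsilon)
  then show ?thesis by simp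
qed

lemma has_vector_derivative_if_right_derivative:
  fixes u :: "real \<Rightarrow> 'a::banach"
  assumes cont: "continuous_on {0..} u" and contv: "continuous_on {0..} v"
    and der: "\<And>t. t \<ge> 0 \<Longrightarrow> (u has_vector_derivative v t) (at t within {t..})"
    and t: "t \<ge> 0"
  shows "(u has_vector_derivative v t) (at t within {0..})"
proof -
  define w where "w t = integral {0..t} v" for t
  have w: "(w has_vector_derivative v t) (at t within {0..})" if "t \<ge> 0" for t
  proof -
    have "(w has_vector_derivative v t) (at t within {0..t+1})"
      unfolding w_def
      by (rule integral_has_vector_derivative) (use that in \<open>auto intro: continuous_on_subset[OF contv]\<close>)
    moreover have "at t within {0..t+1} = at t within {0..}"
      by (rule at_within_nhd[of _ "{..<t+1}"]) auto
    ultimately show ?thesis by simp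
  qed
  have contw: "continuous_on {0..} w"
    using w by (auto simp: continuous_on_eq_continuous_within intro: has_vector_derivative_continuous)
  have const: "u s - w s = u 0" if "s \<ge> 0" for s
  proof -
    have "u s - w s = u 0 - w 0"
    proof (rule constant_if_right_derivative_zero[OF _ _ that, where u = "\<lambda>s. u s - w s"])
      show "continuous_on {0..} (\<lambda>s. u s - w s)" by (intro continuous_intros cont contw)
      fix t :: real assume t: "t \<ge> 0"
      have "(w has_vector_derivative v t) (at t within {t..})"
        by (rule has_vector_derivative_within_subset[OF w[OF t]]) (use t in auto)
      from has_vector_derivative_diff[OF der[OF t] this]
      show "((\<lambda>s. u s - w s) has_vector_derivative 0) (at t within {t..})" by simp
    qed
    then show ?thesis by (simp add: w_def)
  qed
  have "((\<lambda>s. u 0 + w s) has_vector_derivative v t) (at t within {0..})"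
    using w[OF t] by (auto intro!: derivative_eq_intros)
  then show ?thesis
  proof (rule has_vector_derivative_transform[rotated 2])
    fix s :: real assume "s \<in> {0..}"
    then have "u s - w s = u 0" by (intro const) simp
    then show "u s = u 0 + w s" by (simp add: diff_eq_eq)
  qed (use t in simp)
qed

section \<open>The triangle and the simplex\<close>

lemma prob_simplex_hat: "x \<in> F \<Longrightarrow> hat x \<in> prob_simplex"
  by (simp add: F_def prob_simplex_def hat_def forall_3 sum_3)

lemma proj12_in_F: "m \<in> prob_simplex \<Longrightarrow> proj12 m \<in> F"
  by (auto simp: F_def prob_simplex_def proj12_def sum_3) (smt (verit))

lemma hat_proj12: "m \<in> prob_simplex \<Longrightarrow> hat (proj12 m) = m"
  by (simp add: prob_simplex_def hat_def proj12_def vec_eq_iff forall_3 sum_3)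

lemma proj12_hat: "proj12 (hat x) = x"
  by (simp add: hat_def proj12_def vec_eq_iff forall_2)

lemma continuous_hat: "continuous_on S hat"
proof -
  have "hat = (\<lambda>x. x $ 1 *\<^sub>R axis 1 1 + x $ 2 *\<^sub>R axis 2 1 + (1 - x $ 1 - x $ 2) *\<^sub>R axis 3 1)"
    by (simp add: fun_eq_iff hat_def vec_eq_iff forall_3 axis_def)
  then show ?thesis by (rule ssubst) (intro continuous_intros)
qed

lemma proj12_eq: "proj12 m = m $ 1 *\<^sub>R axis 1 1 + m $ 2 *\<^sub>R axis 2 1"
  by (simp add: proj12_def vec_eq_iff forall_2 axis_def)

lemma compact_F: "compact F"
proof -
  have "norm x \<le> 1" if "x \<in> F" for x
    using norm_le_l1_cart[of x] that by (simp add: F_def sum_2)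
  then have "bounded F" by (auto simp: bounded_iff)
  moreover have "closed F" unfolding F_def
    by (intro closed_Collect_conj closed_Collect_le continuous_intros)
  ultimately show ?thesis by (simp add: compact_eq_bounded_closed)
qed

lemma convex_F: "convex F"
proof -
  have "F = {m. inner (vector [-1, 0]) m \<le> 0} \<inter> {m. inner (vector [0, -1]) m \<le> 0} \<inter> {m. inner (vector [1, 1]) m \<le> 1}"
    by (auto simp: F_def inner_vec_def sum_2)
  then show ?thesis by (rule ssubst) (intro convex_Int convex_halfspace_le)
qed

lemma measure_F: "measure lebesgue F \<noteq> 0"
proof
  assume "measure lebesgue F = 0"
  then have neg: "negligible F" using compact_F by (simp add: negligible_iff_measure lmeasurable_compact)
  define U :: "(real^2) set" where "U = {m. 0 < m $ 1 \<and> 0 < m $ 2 \<and> m $ 1 + m $ 2 < 1}"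
  have "open U" unfolding U_def
    by (intro open_Collect_conj open_Collect_less continuous_intros)
  moreover have "vector [1/3, 1/3] \<in> U" by (simp add: U_def)
  moreover have "negligible U" by (rule negligible_subset[OF neg]) (auto simp: U_def F_def)
  ultimately show False using open_not_negligible by blast
qed

section \<open>Nonlinear Markov semigroups\<close>

lemma markov_semigroup_in_simplex:
  assumes "nonlinear_markov_semigroup \<Phi>" "t \<ge> 0" "m \<in> prob_simplex"
  shows "\<Phi> t m \<in> prob_simplex"
proof -
  obtain P where P: "nonlinear_transition_probabilities P"
    "\<And>j. \<Phi> t m $ j = (\<Sum>i\<in>UNIV. m $ i * P t m $ i $ j)"
    using assms unfolding nonlinear_markov_semigroup_def by blast
  have st: "stochastic_matrix (P t m)" using P(1) assms unfolding nonlinear_transition_probabilities_def by blast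
  have "(\<Sum>j\<in>UNIV. \<Phi> t m $ j) = (\<Sum>i\<in>UNIV. m $ i * (\<Sum>j\<in>UNIV. P t m $ i $ j))"
    unfolding P(2) by (subst sum.swap) (simp add: sum_distrib_left)
  also have "\<dots> = 1" using st assms(3) by (simp add: stochastic_matrix_def prob_simplex_def)
  finally show ?thesis
    using st assms(3) by (auto simp: P(2) prob_simplex_def stochastic_matrix_def intro!: sum_nonneg)
qed

lemma markov_semigroup_add:
  assumes "nonlinear_markov_semigroup \<Phi>" "t \<ge> 0" "s \<ge> 0" "m \<in> prob_simplex"
  shows "\<Phi> (t + s) m = \<Phi> s (\<Phi> t m)"
proof -
  obtain P where P: "nonlinear_transition_probabilities P"
    "\<And>t m j. t \<ge> 0 \<Longrightarrow> m \<in> prob_simplex \<Longrightarrow> \<Phi> t m $ j = (\<Sum>i\<in>UNIV. m $ i * P t m $ i $ j)"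
    using assms(1) unfolding nonlinear_markov_semigroup_def by blast
  have row: "(\<Sum>l\<in>UNIV. m $ l *\<^sub>R (P t m $ l)) = \<Phi> t m"
    using P(2)[OF assms(2,4)] by (simp add: vec_eq_iff)
  have "\<Phi> (t + s) m $ j = \<Phi> s (\<Phi> t m) $ j" for j
  proof -
    have "\<Phi> (t + s) m $ j = (\<Sum>i\<in>UNIV. m $ i * P (t + s) m $ i $ j)"
      using P(2) assms by simp
    also have "\<dots> = (\<Sum>i\<in>UNIV. \<Sum>k\<in>UNIV. m $ i * P t m $ i $ k * P s (\<Phi> t m) $ k $ j)"
      using P(1) assms(2-4) unfolding nonlinear_transition_probabilities_def row[symmetric] by blast
    also have "\<dots> = (\<Sum>k\<in>UNIV. (\<Sum>i\<in>UNIV. m $ i * P t m $ i $ k) * P s (\<Phi> t m) $ k $ j)"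
      by (subst sum.swap) (simp add: sum_distrib_right)
    also have "\<dots> = (\<Sum>k\<in>UNIV. \<Phi> t m $ k * P s (\<Phi> t m) $ k $ j)"
      using P(2)[OF assms(2,4)] by simp
    also have "\<dots> = \<Phi> s (\<Phi> t m) $ j"
      using P(2)[OF assms(3) markov_semigroup_in_simplex[OF assms(1,2,4)]] by simp
    finally show ?thesis .
  qed
  then show ?thesis by (simp add: vec_eq_iff)
qed

lemma markov_semigroup_continuous:
  assumes "nonlinear_markov_semigroup \<Phi>"
  shows "continuous_on ({0..} \<times> prob_simplex) (\<lambda>(t, m). \<Phi> t m $ j)"
proof -
  obtain P where P: "nonlinear_transition_probabilities P"
    "\<And>t m j. t \<ge> 0 \<Longrightarrow> m \<in> prob_simplex \<Longrightarrow> \<Phi> t m $ j = (\<Sum>i\<in>UNIV. m $ i * P t m $ i $ j)"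
    using assms(1) unfolding nonlinear_markov_semigroup_def by blast
  have "continuous_on ({0..} \<times> prob_simplex) (\<lambda>p. P (fst p) (snd p))"
    using P(1) by (simp add: nonlinear_transition_probabilities_def split_beta)
  then have "continuous_on ({0..} \<times> prob_simplex) (\<lambda>p. \<Sum>i\<in>UNIV. snd p $ i * P (fst p) (snd p) $ i $ j)"
    by (intro continuous_intros)
  then show ?thesis
    by (rule continuous_on_eq) (auto simp: P(2))
qed

theorem theorem5p2:
  fixes Q :: "real^3 \<Rightarrow> real^3^3"
    and \<Phi> :: "real \<Rightarrow> real^3 \<Rightarrow> real^3"
    and D :: "(real^2) set"
    and f :: "real^2 \<Rightarrow> real^2"
    and mbar :: "real^3"
  assumes semigroup: "nonlinear_markov_semigroup \<Phi>"
    and generator: "nonlinear_generator Q \<Phi>"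
    and D: "region D" "simply_connected D" "bounded D" "F \<subseteq> D"
    and C1: "continuously_differentiable_on f D"
    and f1: "\<And>m. m \<in> F \<Longrightarrow>
      f m $ 1 = Q (hat m) $ 3 $ 1 + (Q (hat m) $ 1 $ 1 - Q (hat m) $ 3 $ 1) * m $ 1
                + (Q (hat m) $ 2 $ 1 - Q (hat m) $ 3 $ 1) * m $ 2"
    and f2: "\<And>m. m \<in> F \<Longrightarrow>
      f m $ 2 = Q (hat m) $ 3 $ 2 + (Q (hat m) $ 1 $ 2 - Q (hat m) $ 3 $ 2) * m $ 1
                + (Q (hat m) $ 2 $ 2 - Q (hat m) $ 3 $ 2) * m $ 2"
    and mbar: "invariant_distribution Q mbar"
    and mbar_unique: "\<And>m. invariant_distribution Q m \<Longrightarrow> m = mbar"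
    and a: "(\<forall>m\<in>D. partial_derivative f 1 1 m + partial_derivative f 2 2 m > 0) \<or>
            (\<forall>m\<in>D. partial_derivative f 1 1 m + partial_derivative f 2 2 m < 0)"
    and b: "partial_derivative f 1 1 (proj12 mbar) * partial_derivative f 2 2 (proj12 mbar)
            - partial_derivative f 1 2 (proj12 mbar) * partial_derivative f 2 1 (proj12 mbar) > 0 \<or>
            (partial_derivative f 1 1 (proj12 mbar) + partial_derivative f 2 2 (proj12 mbar))\<^sup>2
            - 4 * (partial_derivative f 1 1 (proj12 mbar) * partial_derivative f 2 2 (proj12 mbar)
              - partial_derivative f 1 2 (proj12 mbar) * partial_derivative f 2 1 (proj12 mbar)) < 0"
  shows "strongly_ergodic \<Phi>"
proof -
  define J where "J x = jacobian f (at x)" for x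
  define \<phi> where "\<phi> t x = proj12 (\<Phi> t (hat x))" for t x
  define p where "p = proj12 mbar"
  have simplex: "\<Phi> t m \<in> prob_simplex" if "t \<ge> 0" "m \<in> prob_simplex" for t m
    by (rule markov_semigroup_in_simplex[OF semigroup that])
  have hat_\<phi>: "hat (\<phi> t x) = \<Phi> t (hat x)" if "t \<ge> 0" "x \<in> F" for t x
    using hat_proj12[OF simplex[OF that(1) prob_simplex_hat[OF that(2)]]] by (simp add: \<phi>_def)
  have \<phi>_F: "\<phi> t x \<in> F" if "t \<ge> 0" "x \<in> F" for t x
    unfolding \<phi>_def by (intro proj12_in_F simplex that prob_simplex_hat)
  have \<phi>_0: "\<phi> 0 x = x" if "x \<in> F" for x
    using semigroup prob_simplex_hat[OF that] by (simp add: \<phi>_def nonlinear_markov_semigroup_def proj12_hat)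
  have \<phi>_add: "\<phi> (s + t) x = \<phi> s (\<phi> t x)" if "s \<ge> 0" "t \<ge> 0" "x \<in> F" for s t x
    using markov_semigroup_add[OF semigroup that(2,1) prob_simplex_hat[OF that(3)]] hat_\<phi>[OF that(2,3)]
    by (simp add: \<phi>_def add.commute)
  have \<phi>_cont: "continuous_on ({0..} \<times> F) (\<lambda>(t, x). \<phi> t x)"
  proof -
    have chat: "continuous_on ({0..} \<times> F) (\<lambda>q. hat (snd q))"
      by (rule continuous_on_compose2[OF continuous_hat[of UNIV]]) (auto intro: continuous_intros)
    have comp: "continuous_on ({0..} \<times> F) (\<lambda>q. \<Phi> (fst q) (hat (snd q)) $ j)" for j
      by (rule continuous_on_compose2[OF markov_semigroup_continuous[OF semigroup, of j], of _ "\<lambda>q. (fst q, hat (snd q))", simplified split_conv])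
        (auto intro!: continuous_intros chat prob_simplex_hat)
    show ?thesis
      unfolding \<phi>_def proj12_eq split_beta
      by (intro continuous_on_add continuous_on_scaleR continuous_on_const comp)
  qed
  have f_eq: "f x = (\<Sum>i\<in>UNIV. hat x $ i * Q (hat x) $ i $ 1) *\<^sub>R axis 1 1 + (\<Sum>i\<in>UNIV. hat x $ i * Q (hat x) $ i $ 2) *\<^sub>R axis 2 1"
    if "x \<in> F" for x
    using f1[OF that] f2[OF that]
    by (simp add: vec_eq_iff forall_2 axis_def sum_3 hat_def algebra_simps)
  have f_deriv: "(f has_derivative (*v) (J x)) (at x)" if "x \<in> D" for x
    using C1 that jacobian_works[of f "at x"] by (simp add: continuously_differentiable_on_def J_def)
  have cont_J: "continuous_on D J" using C1 by (simp add: continuously_differentiable_on_def J_def[abs_def])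
  have cont_f: "continuous_on F f"
    using f_deriv \<open>F \<subseteq> D\<close> by (meson has_derivative_at_withinI has_derivative_continuous_on subsetD)
  \<comment> \<open>The semigroup property carries the derivative at time zero to a right derivative at time \<open>t\<close>.\<close>
  have \<phi>_deriv: "((\<lambda>t. \<phi> t x) has_vector_derivative f (\<phi> t x)) (at t within {0..})"
    if t: "t \<ge> 0" and x: "x \<in> F" for t x
  proof (rule has_vector_derivative_if_right_derivative[OF _ _ _ t])
    show cx: "continuous_on {0..} (\<lambda>t. \<phi> t x)"
      by (rule continuous_on_compose2[OF \<phi>_cont, of _ "\<lambda>t. (t, x)", simplified split_conv])
        (use x in \<open>auto intro!: continuous_intros\<close>)
    show "continuous_on {0..} (\<lambda>t. f (\<phi> t x))"
      by (rule continuous_on_compose2[OF cont_f cx]) (use x \<phi>_F in auto)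
    fix t :: real assume t: "t \<ge> 0"
    let ?m = "\<Phi> t (hat x)"
    have m: "?m \<in> prob_simplex" using simplex[OF t prob_simplex_hat[OF x]] .
    have comp: "((\<lambda>s. \<Phi> (s - t) ?m $ j) has_vector_derivative (\<Sum>i\<in>UNIV. ?m $ i * Q ?m $ i $ j)) (at t within {t..})" for j
    proof -
      have "((\<lambda>s. \<Phi> s ?m $ j) \<circ> (\<lambda>s. s - t) has_vector_derivative 1 *\<^sub>R (\<Sum>i\<in>UNIV. ?m $ i * Q ?m $ i $ j)) (at t within {t..})"
      proof (rule vector_diff_chain_within)
        show "((\<lambda>s. s - t) has_vector_derivative 1) (at t within {t..})" by (auto intro!: derivative_eq_intros)
        have "(\<lambda>s. s - t) ` {t..} = {0..}" by (auto simp: image_iff intro!: bexI[of _ "_ + t"])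
        then show "((\<lambda>s. \<Phi> s ?m $ j) has_vector_derivative (\<Sum>i\<in>UNIV. ?m $ i * Q ?m $ i $ j)) (at (t - t) within (\<lambda>s. s - t) ` {t..})"
          using generator m unfolding nonlinear_generator_def has_real_derivative_iff_has_vector_derivative by simp
      qed
      then show ?thesis by (simp add: o_def)
    qed
    have shifted: "((\<lambda>s. proj12 (\<Phi> (s - t) ?m)) has_vector_derivative f (\<phi> t x)) (at t within {t..})"
      unfolding proj12_eq f_eq[OF \<phi>_F[OF t x]] hat_\<phi>[OF t x]
      by (intro has_vector_derivative_add bounded_linear.has_vector_derivative[OF bounded_linear_scaleR_left] comp)
    have eq: "\<phi> s x = proj12 (\<Phi> (s - t) ?m)" if "s \<in> {t..}" for s
      using markov_semigroup_add[OF semigroup t, of "s - t" "hat x"] that prob_simplex_hat[OF x] by (simp add: \<phi>_def)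
    show "((\<lambda>t. \<phi> t x) has_vector_derivative f (\<phi> t x)) (at t within {t..})"
      by (rule has_vector_derivative_transform[OF _ eq shifted]) auto
  qed
  interpret planar_semiflow D F f J \<phi>
  proof
    show "open D" using D(1) by (simp add: region_def)
  qed (use f_deriv cont_J compact_F convex_F D(4) \<phi>_F \<phi>_0 \<phi>_add \<phi>_cont \<phi>_deriv in auto)
  \<comment> \<open>A positive divergence would force the area of the forward invariant triangle to vanish.\<close>
  have div: "J x $ 1 $ 1 + J x $ 2 $ 2 < 0" if "x \<in> D" for x
    using a measure_F expanding_imp_null that unfolding J_def by blast
  have mb: "mbar \<in> prob_simplex" using mbar by (simp add: invariant_distribution_def)
  have pF: "p \<in> F" unfolding p_def by (rule proj12_in_F[OF mb])
  have hat_p: "hat p = mbar" unfolding p_def by (rule hat_proj12[OF mb])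
  have fp: "f p = 0"
    unfolding f_eq[OF pF] hat_p using mbar
    by (simp add: invariant_distribution_def vec_eq_iff vector_matrix_mult_def mult.commute)
  have zeros: "x = p" if x: "x \<in> F" "f x = 0" for x
  proof -
    let ?m = "hat x"
    have m: "?m \<in> prob_simplex" by (rule prob_simplex_hat[OF x(1)])
    have 12: "(\<Sum>i\<in>UNIV. ?m $ i * Q ?m $ i $ 1) = 0" "(\<Sum>i\<in>UNIV. ?m $ i * Q ?m $ i $ 2) = 0"
      using x(2) unfolding f_eq[OF x(1)] by (simp_all add: vec_eq_iff forall_2 axis_def)
    have rows: "Q ?m $ i $ 3 = - Q ?m $ i $ 1 - Q ?m $ i $ 2" for i
    proof -
      have "(\<Sum>j\<in>UNIV. Q ?m $ i $ j) = 0"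
        using generator m
        unfolding nonlinear_generator_def transition_rate_matrix_function_def transition_rate_matrix_def
        by blast
      then show ?thesis unfolding sum_3 by linarith
    qed
    have "(\<Sum>i\<in>UNIV. ?m $ i * Q ?m $ i $ 3)
        = - (\<Sum>i\<in>UNIV. ?m $ i * Q ?m $ i $ 1) - (\<Sum>i\<in>UNIV. ?m $ i * Q ?m $ i $ 2)"
      unfolding rows by (simp add: right_diff_distrib sum_subtractf sum_negf)
    then have 3: "(\<Sum>i\<in>UNIV. ?m $ i * Q ?m $ i $ 3) = 0" unfolding 12 by simp
    have "?m v* Q ?m = 0"
      using 12 3 by (simp add: vec_eq_iff forall_3 vector_matrix_mult_def mult.commute)
    then have "?m = mbar" using mbar_unique m by (simp add: invariant_distribution_def)
    then show ?thesis using proj12_hat[of x] by (simp add: p_def)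
  qed
  \<comment> \<open>A negative discriminant also makes the determinant positive.\<close>
  have pos: "0 < d" if "0 < d \<or> s\<^sup>2 - 4 * d < 0" for s d :: real
    using that zero_le_power2[of s] by linarith
  have "det (J p) > 0"
    using pos[OF b] by (simp add: det_2 J_def p_def)
  then obtain r where r: "r > 0" "\<And>x. x \<in> F \<Longrightarrow> dist x p < r \<Longrightarrow> ((\<lambda>t. \<phi> t x) \<longlongrightarrow> p) at_top"
    using linearly_stable_imp_attracting[OF pF fp div] pF K(3) by blast
  show ?thesis
    unfolding strongly_ergodic_def
  proof (intro bexI[OF _ mb] ballI)
    fix m0 :: "real^3" assume m0: "m0 \<in> prob_simplex"
    have x: "proj12 m0 \<in> F" by (rule proj12_in_F[OF m0])
    have "((\<lambda>t. \<phi> t (proj12 m0)) \<longlongrightarrow> p) at_top"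
      by (rule contracting_flow_converges[OF div zeros r x])
    then have "((\<lambda>t. hat (\<phi> t (proj12 m0))) \<longlongrightarrow> hat p) at_top"
      using continuous_hat[of UNIV] by (intro isCont_tendsto_compose[of p hat]) (auto simp: continuous_on_eq_continuous_at)
    moreover have "\<forall>\<^sub>F t in at_top. hat (\<phi> t (proj12 m0)) = \<Phi> t m0"
      using eventually_ge_at_top[of "0::real"]
      by eventually_elim (use hat_\<phi> x hat_proj12[OF m0] in simp)
    ultimately have "((\<lambda>t. \<Phi> t m0) \<longlongrightarrow> mbar) at_top"
      unfolding hat_p by (rule Lim_transform_eventually)
    then show "((\<lambda>t. norm (\<Phi> t m0 - mbar)) \<longlongrightarrow> 0) at_top"
      by (simp add: LIM_zero tendsto_norm_zero)
  qed
qed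

end
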